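(* Let $X$ be a complex Banach space and let $A:D(A)\subset X\to X$ be a densely defined closed linear operator with $\rho(A)\neq\emptyset$. Let $P(\lambda)$ be a polynomial with complex coefficients. Then $\sigma_{BF}(P(A))=P(\sigma_{BF}(A))$, and $A$ has a purely B-discrete spectrum if and only if $P(A)$ has a purely B-discrete spectrum.
   Context: If $P$ has degree $n$, $P(A)$ is the closed operator with domain $D(A^n)$ given by the usual polynomial expression in $A$. For a closed linear operator $T:D(T)\subset X\to X$, write $N(T)$, $R(T)$ for its nullspace and range, $\sigma(T)$, $\rho(T)$ for its spectrum and resolvent set. Ascent: $a(T)=\inf\{n\in\mathbb N: N(T^n)=N(T^{n+1})\}$; descent: $\delta(T)=\inf\{n\in\mathbb N: R(T^n)=R(T^{n+1})\}$ (with $\inf\emptyset=\infty$, $\mathbb N=\{0,1,2,\dots\}$, and $T^n$ defined on its natural domain). $T$ is Drazin invertible if $a(T)$ and $\delta(T)$ are both finite. The Drazin spectrum is $\sigma_{D}(T)=\{\lambda\in\mathbb C: T-\lambda I\text{ is not Drazin invertible}\}$. The B-discrete spectrum is $\sigma_{bd}(T)=\sigma(T)\setminus\sigma_D(T)$, and $T$ has a purely B-discrete spectrum if $\sigma(T)=\sigma_{bd}(T)$. A closed operator is Fredholm if its nullspace has finite dimension and its range has finite codimension. A closed operator $T$ is B-Fredholm if there is an integer $n\ge 0$ such that $R(T^n)$ is closed and the restriction $T_{[n]}: D(T)\cap R(T^n)\to R(T^n)$ of $T$, viewed as an operator from $R(T^n)$ to $R(T^n)$, is Fredholm. The B-Fredholm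 spectrum is $\sigma_{BF}(T)=\{\lambda\in\mathbb C: T-\lambda I\text{ is not a B-Fredholm operator}\}$.
   Formalization: The polynomial P is assumed non-constant: for constant P = c, P(A) = cI has empty B-Fredholm spectrum and is always purely B-discrete, so both claims fail e.g. for the left shift on l^2. *)

theory Defs
  imports
    "HOL-Analysis.Analysis"
    "HOL-Library.Extended_Nat"
    "HOL-Computational_Algebra.Polynomial"
begin

section \<open>Complex Banach spaces\<close>

class complex_banach = banach +
  fixes scaleC :: "complex \<Rightarrow> 'a \<Rightarrow> 'a" (infixr "*\<^sub>C" 75)
  assumes scaleC_add_right: "c *\<^sub>C (x + y) = c *\<^sub>C x + c *\<^sub>C y"
    and scaleC_add_left: "(c + d) *\<^sub>C x = c *\<^sub>C x + d *\<^sub>C x"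
    and scaleC_scaleC: "c *\<^sub>C (d *\<^sub>C x) = (c * d) *\<^sub>C x"
    and scaleR_scaleC: "r *\<^sub>R x = complex_of_real r *\<^sub>C x"
    and norm_scaleC: "norm (c *\<^sub>C x) = cmod c * norm x"

global_interpretation complex_vector:
  vector_space "scaleC :: complex \<Rightarrow> 'a \<Rightarrow> 'a::complex_banach"
proof
  show "1 *\<^sub>C x = x" for x :: 'a
    using scaleR_scaleC[of 1 x] by simp
qed (simp_all add: scaleC_add_right scaleC_add_left scaleC_scaleC)

abbreviation csubspace :: "'a::complex_banach set \<Rightarrow> bool"
  where "csubspace \<equiv> complex_vector.subspace"

abbreviation cspan :: "'a::complex_banach set \<Rightarrow> 'a set"
  where "cspan \<equiv> complex_vector.span"

instantiation complex :: complex_banach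
begin

definition scaleC_complex :: "complex \<Rightarrow> complex \<Rightarrow> complex"
  where "scaleC_complex c x = c * x"

instance
  by standard (simp_all add: scaleC_complex_def algebra_simps norm_mult scaleR_conv_of_real)

end

section \<open>Unbounded linear operators\<close>

text \<open>
  An operator is given by its domain and a total function. The values of the function outside
  the domain are irrelevant: no notion below depends on them.
\<close>

record 'a operator =
  op_dom :: "'a set"
  op_app :: "'a \<Rightarrow> 'a"

definition null_space :: "'a::zero operator \<Rightarrow> 'a set"
  where "null_space T = {x \<in> op_dom T. op_app T x = 0}"

definition range_space :: "'a operator \<Rightarrow> 'a set"
  where "range_space T = op_app T ` op_dom T"

definition linear_operator :: "'a::complex_banach operator \<Rightarrow> bool"
  where "linear_operator T \<longleftrightarrow>
    csubspace (op_dom T) \<and>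
    (\<forall>x\<in>op_dom T. \<forall>y\<in>op_dom T. op_app T (x + y) = op_app T x + op_app T y) \<and>
    (\<forall>c. \<forall>x\<in>op_dom T. op_app T (c *\<^sub>C x) = c *\<^sub>C op_app T x)"

definition closed_operator :: "'a::complex_banach operator \<Rightarrow> bool"
  where "closed_operator T \<longleftrightarrow>
    linear_operator T \<and> closed {(x, op_app T x) |x. x \<in> op_dom T}"

definition densely_defined :: "'a::complex_banach operator \<Rightarrow> bool"
  where "densely_defined T \<longleftrightarrow> closure (op_dom T) = UNIV"

definition op_shift :: "'a::complex_banach operator \<Rightarrow> complex \<Rightarrow> 'a operator"
  where "op_shift T \<mu> = \<lparr>op_dom = op_dom T, op_app = (\<lambda>x. op_app T x - \<mu> *\<^sub>C x)\<rparr>"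

primrec op_power :: "'a operator \<Rightarrow> nat \<Rightarrow> 'a operator" where
  "op_power T 0 = \<lparr>op_dom = UNIV, op_app = (\<lambda>x. x)\<rparr>"
| "op_power T (Suc n) =
    \<lparr>op_dom = {x \<in> op_dom (op_power T n). op_app (op_power T n) x \<in> op_dom T},
     op_app = (\<lambda>x. op_app T (op_app (op_power T n) x))\<rparr>"

definition op_poly :: "complex poly \<Rightarrow> 'a::complex_banach operator \<Rightarrow> 'a operator"
  where "op_poly P T =
    \<lparr>op_dom = op_dom (op_power T (degree P)),
     op_app = (\<lambda>x. \<Sum>k\<le>degree P. coeff P k *\<^sub>C op_app (op_power T k) x)\<rparr>"

section \<open>Spectra\<close>

definition resolvent_set :: "'a::complex_banach operator \<Rightarrow> complex set"
  where "resolvent_set T =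
    {\<mu>. bij_betw (op_app (op_shift T \<mu>)) (op_dom T) UNIV \<and>
        bounded_linear (inv_into (op_dom T) (op_app (op_shift T \<mu>)))}"

definition spectrum :: "'a::complex_banach operator \<Rightarrow> complex set"
  where "spectrum T = - resolvent_set T"

text \<open>In \<^typ>\<open>enat\<close>, the infimum of the empty set is \<open>\<infinity>\<close>.\<close>

definition ascent :: "'a::complex_banach operator \<Rightarrow> enat"
  where "ascent T = Inf {enat n |n. null_space (op_power T n) = null_space (op_power T (Suc n))}"

definition descent :: "'a::complex_banach operator \<Rightarrow> enat"
  where "descent T = Inf {enat n |n. range_space (op_power T n) = range_space (op_power T (Suc n))}"

definition drazin_invertible :: "'a::complex_banach operator \<Rightarrow> bool"
  where "drazin_invertible T \<longleftrightarrow> ascent T \<noteq> \<infinity> \<and> descent T \<noteq> \<infinity>"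

definition drazin_spectrum :: "'a::complex_banach operator \<Rightarrow> complex set"
  where "drazin_spectrum T = {\<mu>. \<not> drazin_invertible (op_shift T \<mu>)}"

definition b_discrete_spectrum :: "'a::complex_banach operator \<Rightarrow> complex set"
  where "b_discrete_spectrum T = spectrum T - drazin_spectrum T"

definition purely_b_discrete :: "'a::complex_banach operator \<Rightarrow> bool"
  where "purely_b_discrete T \<longleftrightarrow> spectrum T = b_discrete_spectrum T"

definition finite_dim :: "'a::complex_banach set \<Rightarrow> bool"
  where "finite_dim S \<longleftrightarrow> (\<exists>B. finite B \<and> B \<subseteq> S \<and> S \<subseteq> cspan B)"

text \<open>The quotient of \<open>Y\<close> by its subspace \<open>R\<close> is spanned by the classes of finitely many vectors.\<close>

definition finite_codim_in :: "'a::complex_banach set \<Rightarrow> 'a set \<Rightarrow> bool"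
  where "finite_codim_in Y R \<longleftrightarrow>
    (\<exists>B. finite B \<and> B \<subseteq> Y \<and> (\<forall>y\<in>Y. \<exists>b\<in>cspan B. y - b \<in> R))"

text \<open>
  \<open>T\<close> is Fredholm as an operator from the Banach space \<open>Y\<close> to itself, where \<open>Y\<close> is a closed
  subspace of the ambient space. As \<open>Y\<close> is closed, the graph of \<open>T\<close> is closed in \<open>Y \<times> Y\<close> iff it
  is closed in the ambient product, so \<^const>\<open>closed_operator\<close> can be reused.
\<close>

definition fredholm_in :: "'a::complex_banach set \<Rightarrow> 'a operator \<Rightarrow> bool"
  where "fredholm_in Y T \<longleftrightarrow>
    csubspace Y \<and> closed Y \<and> op_dom T \<subseteq> Y \<and> range_space T \<subseteq> Y \<and>
    closed_operator T \<and> finite_dim (null_space T) \<and> finite_codim_in Y (range_space T)"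

definition op_restrict :: "'a operator \<Rightarrow> nat \<Rightarrow> 'a operator"
  where "op_restrict T n =
    \<lparr>op_dom = op_dom T \<inter> range_space (op_power T n), op_app = op_app T\<rparr>"

definition b_fredholm :: "'a::complex_banach operator \<Rightarrow> bool"
  where "b_fredholm T \<longleftrightarrow> closed_operator T \<and>
    (\<exists>n. closed (range_space (op_power T n)) \<and>
         fredholm_in (range_space (op_power T n)) (op_restrict T n))"

definition b_fredholm_spectrum :: "'a::complex_banach operator \<Rightarrow> complex set"
  where "b_fredholm_spectrum T = {\<mu>. \<not> b_fredholm (op_shift T \<mu>)}"

end

theory Submission
  imports Defs "HOL-Computational_Algebra.Computational_Algebra" "HOL-Computational_Algebra.Field_as_Ring"
begin

text \<open>
  Fix \<open>\<mu>\<close> in the resolvent set, let \<open>R = (A - \<mu>)\<inverse>\<close> and \<open>m = degree Q\<close>. Then \<open>Q(A) = p(R) R\<^sup>-\<^sup>m\<close> for a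
  polynomial \<open>p\<close> with \<open>p(0) \<noteq> 0\<close>, and since \<open>p\<close> is coprime to every power of the variable, the powers of
  \<open>Q(A)\<close> have exactly the same kernels and ranges as those of the bounded operator \<open>p(R)\<close>.

  For a bounded operator \<open>B\<close>, B-Fredholmness means that for some \<open>n \<ge> 1\<close> the spaces \<open>N(B\<^sup>n) \<inter> R(B\<^sup>n)\<close> and
  \<open>X / (N(B\<^sup>n) + R(B\<^sup>n))\<close> are finite-dimensional (the closedness of \<open>R(B\<^sup>n)\<close> then follows from the open
  mapping theorem), and Drazin invertibility means that they vanish. Both conditions pass to products
  of coprime polynomials in \<open>R\<close> and to their factors by Bezout's identity. Splitting \<open>P - \<nu>\<close> into linear
  factors gives the spectral mapping theorem for the B-Fredholm and the Drazin spectrum, and a purely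
  B-discrete spectrum means that the Drazin spectrum is empty.
\<close>

section \<open>Finite-dimensional sets and other small sets\<close>

abbreviation clinear :: "('a::complex_banach \<Rightarrow> 'b::complex_banach) \<Rightarrow> bool"
  where "clinear \<equiv> Vector_Spaces.linear scaleC scaleC"

lemma clinearI:
  assumes "\<And>x y. f (x + y) = f x + f y" "\<And>c x. f (c *\<^sub>C x) = c *\<^sub>C f x"
  shows "clinear f"
  using assms by unfold_locales auto

lemma clinear_span_image:
  assumes "clinear f"
  shows "cspan (f ` B) = f ` cspan B"
proof -
  interpret f: Vector_Spaces.linear scaleC scaleC f by fact
  show ?thesis by (rule f.span_image)
qed

lemma finite_dim_iff: "finite_dim S \<longleftrightarrow> (\<exists>B. finite B \<and> S \<subseteq> cspan B)"
proof
  assume "\<exists>B. finite B \<and> S \<subseteq> cspan B"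
  then obtain B where B: "finite B" "S \<subseteq> cspan B" by blast
  obtain C where C: "C \<subseteq> S" "complex_vector.independent C" "S \<subseteq> cspan C"
    using complex_vector.maximal_independent_subset by metis
  have "finite C"
    using complex_vector.independent_span_bound[OF B(1) C(2)] B(2) C(1) by auto
  then show "finite_dim S"
    using C unfolding finite_dim_def by blast
qed (auto simp: finite_dim_def)

lemma finite_dim_subset: "finite_dim S \<Longrightarrow> U \<subseteq> S \<Longrightarrow> finite_dim U"
  unfolding finite_dim_iff by (meson subset_trans)

text \<open>Finitely many vectors that span the part of \<open>G\<close> inside the image of
  \<open>V\<close> have preimages in \<open>V\<close>; the span of these preimages serves as
  \<open>W\<close>.\<close>

lemma finite_dim_lift:
  assumes f: "clinear f" and V: "csubspace V" and G: "finite_dim G"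
  shows "\<exists>W. W \<subseteq> V \<and> finite_dim W \<and> G \<inter> f ` V \<subseteq> f ` W"
proof -
  have "finite_dim (G \<inter> f ` V)"
    using finite_dim_subset[OF G] by auto
  then obtain C where C: "finite C" "C \<subseteq> f ` V" "G \<inter> f ` V \<subseteq> cspan C"
    unfolding finite_dim_def by (metis Int_subset_iff)
  then obtain B where B: "finite B" "B \<subseteq> V" "C = f ` B"
    using finite_subset_image by metis
  show ?thesis
  proof (intro exI conjI)
    show "cspan B \<subseteq> V"
      using complex_vector.span_minimal[OF B(2) V] .
    show "finite_dim (cspan B)"
      using B(1) finite_dim_iff by auto
    show "G \<inter> f ` V \<subseteq> f ` cspan B"
      using C(3) clinear_span_image[OF f, of B] B(3) by simp
  qed
qed

text \<open>
  Fredholm and Drazin theory run in parallel once \<open>finite-dimensional\<close> is abstracted to \<open>small\<close>: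
  taking only the sets contained in \<open>{0}\<close> as small turns B-Fredholmness into Drazin invertibility.
\<close>

locale small_sets =
  fixes small :: "'a::complex_banach set \<Rightarrow> bool"
  assumes small_subset: "small S \<Longrightarrow> U \<subseteq> S \<Longrightarrow> small U"
    and small_zero: "small {0}"
    and small_sum: "small S \<Longrightarrow> small U \<Longrightarrow> small {x + y |x y. x \<in> S \<and> y \<in> U}"
    and small_image: "clinear f \<Longrightarrow> small S \<Longrightarrow> small (f ` S)"
    and small_lift: "clinear f \<Longrightarrow> csubspace V \<Longrightarrow> small S \<Longrightarrow>
      \<exists>W. W \<subseteq> V \<and> small W \<and> S \<inter> f ` V \<subseteq> f ` W"
begin

text \<open>An analogue of rank-nullity: once a small \<open>W\<close> lifts the image, every vector
  of \<open>V\<close> differs from one of \<open>W\<close> by a kernel vector in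
  \<open>V\<close>.\<close>

lemma small_vimage:
  assumes f: "clinear f" and V: "csubspace V" and im: "small (f ` V)"
    and ker: "small (V \<inter> {x. f x = 0})"
  shows "small V"
proof -
  interpret f: Vector_Spaces.linear scaleC scaleC f by fact
  obtain W where W: "W \<subseteq> V" "small W" "f ` V \<subseteq> f ` W"
    using small_lift[OF f V im] by auto
  have "V \<subseteq> {x + y |x y. x \<in> V \<inter> {x. f x = 0} \<and> y \<in> W}"
  proof
    fix v assume v: "v \<in> V"
    then obtain w where w: "w \<in> W" "f v = f w"
      using W(3) by blast
    have "v - w \<in> V"
      using v w(1) W(1) V complex_vector.subspace_diff by blast
    then have "v - w \<in> V \<inter> {x. f x = 0}"
      using w(2) by (simp add: f.diff)
    moreover have "v = (v - w) + w" by simp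
    ultimately show "v \<in> {x + y |x y. x \<in> V \<inter> {x. f x = 0} \<and> y \<in> W}"
      using w(1) by blast
  qed
  then show ?thesis
    using small_subset small_sum[OF ker W(2)] by blast
qed

end

lemma finite_dim_sum:
  assumes "finite_dim S" "finite_dim U"
  shows "finite_dim {x + y |x y. x \<in> S \<and> y \<in> U}"
proof -
  obtain B C where B: "finite B" "S \<subseteq> cspan B" and C: "finite C" "U \<subseteq> cspan C"
    using assms unfolding finite_dim_iff by metis
  have "S \<subseteq> cspan (B \<union> C)" "U \<subseteq> cspan (B \<union> C)"
    using B C complex_vector.span_mono[of B "B \<union> C"] complex_vector.span_mono[of C "B \<union> C"]
    by auto
  then have "{x + y |x y. x \<in> S \<and> y \<in> U} \<subseteq> cspan (B \<union> C)"
    by (auto intro: complex_vector.span_add)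
  then show ?thesis
    unfolding finite_dim_iff using B(1) C(1) by (intro exI[of _ "B \<union> C"]) simp
qed

lemma finite_dim_image:
  assumes "clinear f" "finite_dim S"
  shows "finite_dim (f ` S)"
proof -
  obtain B where B: "finite B" "S \<subseteq> cspan B"
    using assms(2) unfolding finite_dim_iff by metis
  then show ?thesis
    unfolding finite_dim_iff using clinear_span_image[OF assms(1), of B]
    by (intro exI[of _ "f ` B"]) auto
qed

interpretation fd: small_sets finite_dim
proof
  show "finite_dim {0 :: 'a}"
    unfolding finite_dim_iff by (rule exI[of _ "{}"]) simp
qed (fact finite_dim_subset finite_dim_sum finite_dim_image finite_dim_lift)+

interpretation trivial: small_sets "\<lambda>S. S \<subseteq> {0}"
proof
  fix f :: "'a::complex_banach \<Rightarrow> 'a" and S V :: "'a set"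
  assume "clinear f" and S: "S \<subseteq> {0}"
  then interpret f: Vector_Spaces.linear scaleC scaleC f by simp
  show "f ` S \<subseteq> {0}"
    using S f.zero by auto
  assume "csubspace V"
  then have "{0} \<subseteq> V"
    using complex_vector.subspace_0 by auto
  moreover have "S \<inter> f ` V \<subseteq> f ` {0}"
    using S f.zero by auto
  ultimately show "\<exists>W. W \<subseteq> V \<and> W \<subseteq> {0} \<and> S \<inter> f ` V \<subseteq> f ` W"
    by blast
qed (auto, force)

section \<open>Polynomials of a bounded operator\<close>

lemma bounded_linear_scaleC_right: "bounded_linear (\<lambda>x::'a::complex_banach. c *\<^sub>C x)"
  by (rule bounded_linear_intro[where K = "cmod c"])
    (simp_all add: scaleC_add_right scaleR_scaleC norm_scaleC mult.commute)

definition poly_op :: "complex poly \<Rightarrow> ('a::complex_banach \<Rightarrow> 'a) \<Rightarrow> 'a \<Rightarrow> 'a"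
  where "poly_op p R x = fold_coeffs (\<lambda>a f y. a *\<^sub>C y + R (f y)) p (\<lambda>y. 0) x"

locale bounded_op =
  fixes R :: "'a::complex_banach \<Rightarrow> 'a"
  assumes bounded: "bounded_linear R" and scale: "R (c *\<^sub>C x) = c *\<^sub>C R x"
begin

abbreviation ev :: "complex poly \<Rightarrow> 'a \<Rightarrow> 'a"
  where "ev p \<equiv> poly_op p R"

abbreviation Null :: "complex poly \<Rightarrow> 'a set"
  where "Null p \<equiv> {x. ev p x = 0}"

abbreviation Range :: "complex poly \<Rightarrow> 'a set"
  where "Range p \<equiv> range (ev p)"

lemma R_zero [simp]: "R 0 = 0"
  using bounded by (rule linear_simps)

lemma R_add: "R (x + y) = R x + R y"
  using bounded by (rule linear_simps)

lemma ev_0 [simp]: "ev 0 x = 0"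
  by (simp add: poly_op_def)

lemma ev_pCons: "ev (pCons a p) x = a *\<^sub>C x + R (ev p x)"
proof (cases "a = 0 \<and> p = 0")
  \<comment> \<open>\<open>pCons 0 0\<close> is the zero polynomial, on which
    \<open>fold_coeffs\<close> makes no step; the recursion then rests on
    \<open>R 0 = 0\<close>.\<close>
  case True
  then show ?thesis by (simp add: poly_op_def)
next
  case False
  then have "fold_coeffs (\<lambda>a f y. a *\<^sub>C y + R (f y)) (pCons a p) =
      (\<lambda>f y. a *\<^sub>C y + R (f y)) \<circ> fold_coeffs (\<lambda>a f y. a *\<^sub>C y + R (f y)) p"
    by (cases "p = 0") auto
  then show ?thesis by (simp add: poly_op_def)
qed

lemma ev_1 [simp]: "ev 1 x = x"
  by (simp add: ev_pCons one_pCons)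

lemma ev_lin_add: "ev p (x + y) = ev p x + ev p y"
  by (induction p) (simp_all add: ev_pCons R_add scaleC_add_right)

lemma ev_lin_scale: "ev p (c *\<^sub>C x) = c *\<^sub>C ev p x"
  by (induction p) (simp_all add: ev_pCons R_add scale scaleC_add_right mult.commute)

lemma clinear_ev: "clinear (ev p)"
  by (intro clinearI ev_lin_add ev_lin_scale)

lemma ev_zero [simp]: "ev p 0 = 0"
  using ev_lin_scale[of p 0 0] by simp

lemma ev_lin_diff: "ev p (x - y) = ev p x - ev p y"
  using ev_lin_add[of p "x - y" y] by simp

lemma ev_add: "ev (p + q) x = ev p x + ev q x"
proof (induction p arbitrary: q)
  case (pCons a p)
  then show ?case
    by (cases q) (simp_all add: ev_pCons R_add scaleC_add_left algebra_simps)
qed simp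

lemma ev_smult: "ev (smult c p) x = c *\<^sub>C ev p x"
  by (induction p) (simp_all add: ev_pCons scale scaleC_add_right)

lemma ev_mult: "ev (p * q) x = ev p (ev q x)"
  by (induction p) (simp_all add: ev_pCons ev_add ev_smult)

lemma ev_commute: "ev p (ev q x) = ev q (ev p x)"
  by (simp add: mult.commute flip: ev_mult)

lemma ev_sum: "ev (\<Sum>i\<in>I. p i) x = (\<Sum>i\<in>I. ev (p i) x)"
  by (induction I rule: infinite_finite_induct) (simp_all add: ev_add)

lemma bounded_linear_ev: "bounded_linear (ev p)"
proof (induction p)
  case 0
  then show ?case by (simp add: poly_op_def)
next
  case (pCons a p)
  have "bounded_linear (\<lambda>x::'a. a *\<^sub>C x)"
    by (rule bounded_linear_scaleC_right)
  moreover have "bounded_linear (\<lambda>x. R (ev p x))"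
    using bounded_linear_compose[OF bounded pCons.IH] .
  ultimately have "bounded_linear (\<lambda>x. a *\<^sub>C x + R (ev p x))"
    by (rule bounded_linear_add)
  then show ?case
    by (simp add: ev_pCons[abs_def])
qed

section \<open>Consequences of Bezout's identity for coprime polynomials\<close>

lemma bezout:
  assumes "coprime p q"
  obtains a b where "\<And>x. x = ev (a * p) x + ev (b * q) x"
proof -
  obtain a b where "a * p + b * q = 1"
    using bezout_coefficients_fst_snd[of p q] assms by (metis coprime_iff_gcd_eq_1)
  then have "x = ev (a * p) x + ev (b * q) x" for x
    using ev_add[of "a * p" "b * q" x] by simp
  then show thesis
    by (rule that)
qed

lemma subspace_Null: "csubspace (Null p)"
  by (auto simp: complex_vector.subspace_def ev_lin_add ev_lin_scale)

lemma subspace_Range: "csubspace (Range p)"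
proof -
  interpret f: Vector_Spaces.linear scaleC scaleC "ev p" by (rule clinear_ev)
  show ?thesis
    using f.subspace_image[OF complex_vector.subspace_UNIV] .
qed

lemma Range_mult_subset: "Range (p * q) \<subseteq> Range p"
  by (auto simp: ev_mult)

lemma Range_power_antimono: "m \<le> n \<Longrightarrow> Range (p ^ n) \<subseteq> Range (p ^ m)"
  using Range_mult_subset[of "p ^ m" "p ^ (n - m)"] by (simp flip: power_add)

lemma Null_mult_subset: "Null q \<subseteq> Null (p * q)"
  by (auto simp: ev_mult)

lemma Null_power_mono: "m \<le> n \<Longrightarrow> Null (p ^ m) \<subseteq> Null (p ^ n)"
  using Null_mult_subset[of "p ^ m" "p ^ (n - m)"] by (simp flip: power_add)

lemma ev_Range: "x \<in> Range p \<Longrightarrow> ev q x \<in> Range p"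
  using ev_commute[of q p] by auto

text \<open>On \<open>Null p\<close> the Bezout summand \<open>b * q\<close> acts as the
  identity.\<close>

lemma Null_subset_Range:
  assumes "coprime p q"
  shows "Null p \<subseteq> Range q"
proof
  fix x assume x: "x \<in> Null p"
  obtain a b where "\<And>x. x = ev (a * p) x + ev (b * q) x"
    using bezout[OF assms] by metis
  from this[of x] x have "x = ev q (ev b x)"
    using ev_commute[of b q x] by (simp add: ev_mult)
  then show "x \<in> Range q" by blast
qed

text \<open>The Bezout summands are used crosswise: the one with factor \<open>p\<close> is applied
  to \<open>x = ev q v\<close>, the one with factor \<open>q\<close> to
  \<open>x = ev p u\<close>.\<close>

lemma Range_mult:
  assumes "coprime p q"
  shows "Range (p * q) = Range p \<inter> Range q"
proof
  show "Range p \<inter> Range q \<subseteq> Range (p * q)"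
  proof
    fix x assume "x \<in> Range p \<inter> Range q"
    then obtain u v where u: "x = ev p u" "x = ev q v" by blast
    obtain a b where ab: "\<And>x. x = ev (a * p) x + ev (b * q) x"
      using bezout[OF assms] by metis
    have "x = ev (a * p) (ev q v) + ev (b * q) (ev p u)"
      using ab[of x] u by simp
    also have "\<dots> = ev (p * q) (ev a v + ev b u)"
      by (simp add: ev_lin_add ev_mult[symmetric] ac_simps)
    finally show "x \<in> Range (p * q)" by blast
  qed
  show "Range (p * q) \<subseteq> Range p \<inter> Range q"
    using Range_mult_subset[of p q] Range_mult_subset[of q p] by (simp add: mult.commute)
qed

text \<open>The two Bezout summands split \<open>x\<close>. Each retains a factor \<open>p\<close>
  or \<open>q\<close>, so the components come with range memberships as well.\<close>

lemma Null_multE: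
  assumes "coprime p q" "x \<in> Null (p * q)"
  obtains y z where "x = y + z" "y \<in> Null p" "z \<in> Null q" "y \<in> Range q" "z \<in> Range p"
proof -
  obtain a b where ab: "\<And>x. x = ev (a * p) x + ev (b * q) x"
    using bezout[OF assms(1)] by metis
  show thesis
  proof (rule that)
    show "x = ev (b * q) x + ev (a * p) x"
      using ab[of x] by (simp add: add.commute)
    have "ev p (ev (b * q) x) = ev b (ev (p * q) x)" "ev q (ev (a * p) x) = ev a (ev (p * q) x)"
      by (simp_all add: ev_mult[symmetric] ac_simps)
    then show "ev (b * q) x \<in> Null p" "ev (a * p) x \<in> Null q"
      using assms(2) by auto
    show "ev (b * q) x \<in> Range q" "ev (a * p) x \<in> Range p"
      using ev_mult[of q b x] ev_mult[of p a x] by (simp_all add: mult.commute)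
  qed
qed

end

section \<open>Almost complementary kernels and ranges\<close>

locale small_bounded_op = small_sets small + bounded_op R
  for small :: "'a::complex_banach set \<Rightarrow> bool" and R :: "'a \<Rightarrow> 'a"
begin

text \<open>The space is the sum of kernel and range up to small errors, and their direct sum if
  only subsets of \<open>{0}\<close> are small. \<open>G\<close> need not be a subspace.\<close>

definition decomposes :: "complex poly \<Rightarrow> bool"
  where "decomposes p \<longleftrightarrow> small (Null p \<inter> Range p) \<and>
    (\<exists>G. small G \<and> (\<forall>x. \<exists>a\<in>Null p. \<exists>b\<in>Range p. \<exists>g\<in>G. x = a + b + g))"

text \<open>The operator induced on \<open>Range (p ^ n)\<close> has small kernel and small
  cokernel. For finite dimension this is the Fredholm property short of closedness.\<close>

definition stabilizes :: "complex poly \<Rightarrow> nat \<Rightarrow> bool"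
  where "stabilizes p n \<longleftrightarrow> small (Null p \<inter> Range (p ^ n)) \<and>
    (\<exists>G. small G \<and> (\<forall>x\<in>Range (p ^ n). \<exists>b\<in>Range (p ^ Suc n). \<exists>g\<in>G. x = b + g))"

text \<open>Exponent 0 is excluded because \<open>p ^ 0 = 1\<close> always decomposes.\<close>

definition eventually_decomposes :: "complex poly \<Rightarrow> bool"
  where "eventually_decomposes p \<longleftrightarrow> (\<exists>n\<ge>1. decomposes (p ^ n))"

text \<open>Coprimality puts \<open>Null p\<close> inside \<open>Range q\<close>, which settles the
  intersection. For the sum, the \<open>Null q\<close> component of a kernel vector lies in
  \<open>Range p\<close> and is absorbed there.\<close>

lemma decomposes_multD:
  assumes pq: "coprime p q" and dec: "decomposes (p * q)"
  shows "decomposes p"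
  unfolding decomposes_def
proof
  have "Null p \<inter> Range p \<subseteq> Null (p * q) \<inter> Range (p * q)"
    using Null_subset_Range[OF pq] Null_mult_subset[of p q]
    by (auto simp: Range_mult[OF pq] mult.commute)
  then show "small (Null p \<inter> Range p)"
    using dec small_subset unfolding decomposes_def by blast
  obtain G where G: "small G"
    "\<And>x. \<exists>a\<in>Null (p * q). \<exists>b\<in>Range (p * q). \<exists>g\<in>G. x = a + b + g"
    using dec unfolding decomposes_def by blast
  have "\<exists>a\<in>Null p. \<exists>b\<in>Range p. \<exists>g\<in>G. x = a + b + g" for x
  proof -
    obtain a b g where x: "a \<in> Null (p * q)" "b \<in> Range (p * q)" "g \<in> G" "x = a + b + g"
      using G(2) by blast
    obtain y z where "a = y + z" "y \<in> Null p" "z \<in> Range p"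
      using Null_multE[OF pq x(1)] by metis
    moreover from this(3) have "z + b \<in> Range p"
      using x(2) Range_mult_subset complex_vector.subspace_add[OF subspace_Range] by blast
    moreover have "x = y + (z + b) + g"
      using x(4) \<open>a = y + z\<close> by (simp add: add.assoc)
    ultimately show ?thesis
      using x(3) by blast
  qed
  then show "\<exists>G. small G \<and> (\<forall>x. \<exists>a\<in>Null p. \<exists>b\<in>Range p. \<exists>g\<in>G. x = a + b + g)"
    using G(1) by blast
qed

text \<open>Kernel vectors of the product split by Bezout, which bounds the intersection. For the
  sum, \<open>u * p\<close> is applied to the splitting for \<open>q\<close> and
  \<open>v * q\<close> to the one for \<open>p\<close>.\<close>

lemma decomposes_multI:
  assumes pq: "coprime p q" and p: "decomposes p" and q: "decomposes q"
  shows "decomposes (p * q)"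
  unfolding decomposes_def
proof
  have "Null (p * q) \<inter> Range (p * q) \<subseteq>
      {x + y |x y. x \<in> Null p \<inter> Range p \<and> y \<in> Null q \<inter> Range q}"
  proof
    fix x assume "x \<in> Null (p * q) \<inter> Range (p * q)"
    then have x: "x \<in> Null (p * q)" "x \<in> Range p" "x \<in> Range q"
      unfolding Range_mult[OF pq] by auto
    obtain y z where yz: "x = y + z" "y \<in> Null p" "z \<in> Null q" "y \<in> Range q" "z \<in> Range p"
      using Null_multE[OF pq x(1)] by metis
    have "x - z \<in> Range p" "x - y \<in> Range q"
      using x yz complex_vector.subspace_diff[OF subspace_Range] by blast+
    then have "y \<in> Range p" "z \<in> Range q"
      using yz(1) by simp_all
    then show "x \<in> {x + y |x y. x \<in> Null p \<inter> Range p \<and> y \<in> Null q \<inter> Range q}"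
      using yz by blast
  qed
  then show "small (Null (p * q) \<inter> Range (p * q))"
    using small_subset small_sum p q unfolding decomposes_def by blast
  obtain G where G: "small G" "\<And>x. \<exists>a\<in>Null p. \<exists>b\<in>Range p. \<exists>g\<in>G. x = a + b + g"
    using p unfolding decomposes_def by blast
  obtain H where H: "small H" "\<And>x. \<exists>a\<in>Null q. \<exists>b\<in>Range q. \<exists>g\<in>H. x = a + b + g"
    using q unfolding decomposes_def by blast
  obtain u v where uv: "\<And>x. x = ev (u * p) x + ev (v * q) x"
    using bezout[OF pq] by metis
  define K where "K = {x + y |x y. x \<in> ev (u * p) ` H \<and> y \<in> ev (v * q) ` G}"
  have "small K"
    unfolding K_def by (intro small_sum small_image clinear_ev G H)
  moreover have "\<exists>a\<in>Null (p * q). \<exists>b\<in>Range (p * q). \<exists>g\<in>K. x = a + b + g" for x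
  proof -
    obtain a b g where x1: "a \<in> Null p" "b \<in> Range p" "g \<in> G" "x = a + b + g"
      using G(2) by blast
    obtain c d h where x2: "c \<in> Null q" "d \<in> Range q" "h \<in> H" "x = c + d + h"
      using H(2) by blast
    have "x = (ev (u * p) c + ev (v * q) a) + (ev (u * p) d + ev (v * q) b) +
        (ev (u * p) h + ev (v * q) g)"
      using uv[of x] arg_cong[OF x2(4), of "ev (u * p)"] arg_cong[OF x1(4), of "ev (v * q)"]
      by (simp add: ev_lin_add)
    moreover have "ev (u * p) c + ev (v * q) a \<in> Null (p * q)"
    proof -
      have "ev (p * q) (ev (u * p) c) = ev (p * u * p) (ev q c)"
        "ev (p * q) (ev (v * q) a) = ev (q * v * q) (ev p a)"
        by (simp_all add: mult_ac flip: ev_mult)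
      then show ?thesis
        using x1(1) x2(1) by (simp add: ev_lin_add)
    qed
    \<comment> \<open>The weight \<open>u * p\<close> supplies the factor \<open>p\<close> that
      \<open>d\<close> lacks, and \<open>v * q\<close> the factor \<open>q\<close> that
      \<open>b\<close> lacks.\<close>
    moreover have "ev (u * p) d + ev (v * q) b \<in> Range (p * q)"
    proof (rule complex_vector.subspace_add[OF subspace_Range])
      obtain b' d' where "b = ev p b'" "d = ev q d'"
        using x1(2) x2(2) by blast
      then have "ev (u * p) d = ev (p * q) (ev u d')" "ev (v * q) b = ev (p * q) (ev v b')"
        by (simp_all add: mult_ac flip: ev_mult)
      then show "ev (u * p) d \<in> Range (p * q)" "ev (v * q) b \<in> Range (p * q)"
        by auto
    qed
    moreover have "ev (u * p) h + ev (v * q) g \<in> K"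
      using x1(3) x2(3) unfolding K_def by blast
    ultimately show ?thesis by blast
  qed
  ultimately show "\<exists>K. small K \<and>
      (\<forall>x. \<exists>a\<in>Null (p * q). \<exists>b\<in>Range (p * q). \<exists>g\<in>K. x = a + b + g)"
    by blast
qed

section \<open>Stabilisation along the powers of a polynomial\<close>

lemma stabilizes_Suc:
  assumes "stabilizes p n"
  shows "stabilizes p (Suc n)"
  unfolding stabilizes_def
proof
  have "Null p \<inter> Range (p ^ Suc n) \<subseteq> Null p \<inter> Range (p ^ n)"
    using Range_power_antimono[of n "Suc n" p] by auto
  then show "small (Null p \<inter> Range (p ^ Suc n))"
    using assms small_subset unfolding stabilizes_def by blast
  obtain G where G: "small G"
    "\<And>x. x \<in> Range (p ^ n) \<Longrightarrow> \<exists>b\<in>Range (p ^ Suc n). \<exists>g\<in>G. x = b + g"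
    using assms unfolding stabilizes_def by blast
  \<comment> \<open>Applying \<open>p\<close> to a splitting one level higher shifts every exponent
    by one and carries the error set \<open>G\<close> to its image.\<close>
  have "\<exists>b\<in>Range (p ^ Suc (Suc n)). \<exists>g\<in>ev p ` G. x = b + g" if x: "x \<in> Range (p ^ Suc n)" for x
  proof -
    obtain u where u: "x = ev p (ev (p ^ n) u)"
      using x by (auto simp: ev_mult)
    obtain w g where "ev (p ^ n) u = ev (p ^ Suc n) w + g" "g \<in> G"
      using G(2)[of "ev (p ^ n) u"] by blast
    then have "x = ev (p ^ Suc (Suc n)) w + ev p g"
      unfolding u by (simp add: ev_lin_add ev_mult)
    then show ?thesis
      using \<open>g \<in> G\<close> by blast
  qed
  then show "\<exists>G. small G \<and> (\<forall>x\<in>Range (p ^ Suc n). \<exists>b\<in>Range (p ^ Suc (Suc n)). \<exists>g\<in>G. x = b + g)"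
    using small_image[OF clinear_ev G(1)] by blast
qed

lemma stabilizes_mono: "stabilizes p n \<Longrightarrow> n \<le> m \<Longrightarrow> stabilizes p m"
  by (rule dec_induct[of n m]) (auto intro: stabilizes_Suc)

text \<open>Induction by \<open>small_vimage\<close>: \<open>p\<close> maps the kernel of
  \<open>p ^ Suc k\<close> into that of \<open>p ^ k\<close> within the same range, and what it
  kills there is small by hypothesis.\<close>

lemma small_Null_power:
  assumes "stabilizes p n"
  shows "small (Null (p ^ k) \<inter> Range (p ^ n))"
proof (induction k)
  case 0
  have "Null (p ^ 0) \<inter> Range (p ^ n) \<subseteq> {0}" by auto
  then show ?case
    using small_zero small_subset by blast
next
  case (Suc k)
  let ?V = "Null (p ^ Suc k) \<inter> Range (p ^ n)"
  have "ev (p ^ k) (ev p x) = ev (p ^ Suc k) x" for x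
    using ev_commute[of "p ^ k" p x] by (simp add: ev_mult)
  then have "ev p ` ?V \<subseteq> Null (p ^ k) \<inter> Range (p ^ n)"
    using ev_Range[of _ "p ^ n" p] by auto
  then have im: "small (ev p ` ?V)"
    using small_subset[OF Suc] by simp
  have "small (Null p \<inter> Range (p ^ n))"
    using assms unfolding stabilizes_def by simp
  then have ker: "small (?V \<inter> Null p)"
    by (rule small_subset) auto
  have "csubspace ?V"
    by (intro complex_vector.subspace_inter subspace_Null subspace_Range)
  then show ?case
    using small_vimage[OF clinear_ev _ im ker] by simp
qed

text \<open>The error sets of \<open>k\<close> single steps add up to one small set.\<close>

lemma stabilizes_Range:
  assumes "stabilizes p n"
  shows "\<exists>G. small G \<and> (\<forall>x\<in>Range (p ^ n). \<exists>b\<in>Range (p ^ (n + k)). \<exists>g\<in>G. x = b + g)"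
proof (induction k)
  case 0
  then show ?case
    using small_zero by (intro exI[of _ "{0}"]) auto
next
  case (Suc k)
  obtain G where G: "small G" "\<And>x. x \<in> Range (p ^ n) \<Longrightarrow> \<exists>b\<in>Range (p ^ (n + k)). \<exists>g\<in>G. x = b + g"
    using Suc by blast
  obtain H where H: "small H"
    "\<And>x. x \<in> Range (p ^ (n + k)) \<Longrightarrow> \<exists>b\<in>Range (p ^ Suc (n + k)). \<exists>g\<in>H. x = b + g"
    using stabilizes_mono[OF assms, of "n + k"] unfolding stabilizes_def by auto
  have "\<exists>b\<in>Range (p ^ (n + Suc k)). \<exists>g\<in>{x + y |x y. x \<in> H \<and> y \<in> G}. x = b + g"
    if x: "x \<in> Range (p ^ n)" for x
  proof -
    obtain b g where "b \<in> Range (p ^ (n + k))" "g \<in> G" "x = b + g"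
      using G(2)[OF x] by blast
    moreover obtain c h where "c \<in> Range (p ^ Suc (n + k))" "h \<in> H" "b = c + h"
      using H(2)[OF calculation(1)] by blast
    ultimately show ?thesis
      by (intro bexI[of _ c] bexI[of _ "h + g"]) (auto simp: add.assoc)
  qed
  then show ?case
    using small_sum[OF H(1) G(1)] by blast
qed

text \<open>With \<open>f = p ^ n\<close>, the vector \<open>f x\<close> differs from some
  \<open>f (f u)\<close> by an error that is itself an image under \<open>f\<close>. Lifting this
  error to \<open>w\<close> in a small set puts \<open>x - f u - w\<close> into the kernel.\<close>

lemma stabilizes_imp_decomposes:
  assumes "stabilizes p n"
  shows "decomposes (p ^ n)"
proof -
  let ?f = "ev (p ^ n)"
  obtain G where G: "small G" "\<And>x. x \<in> Range (p ^ n) \<Longrightarrow> \<exists>b\<in>Range (p ^ (n + n)). \<exists>g\<in>G. x = b + g"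
    using stabilizes_Range[OF assms] by blast
  obtain W where W: "small W" "G \<inter> Range (p ^ n) \<subseteq> ?f ` W"
    using small_lift[OF clinear_ev complex_vector.subspace_UNIV G(1)] by blast
  have "\<exists>a\<in>Null (p ^ n). \<exists>b\<in>Range (p ^ n). \<exists>g\<in>W. x = a + b + g" for x
  proof -
    obtain u g where u: "?f x = ?f (?f u) + g" "g \<in> G"
      using G(2)[of "?f x"] by (auto simp: power_add ev_mult)
    then have "g = ?f (x - ?f u)"
      by (simp add: ev_lin_diff)
    then obtain w where w: "w \<in> W" "g = ?f w"
      using u(2) W(2) by blast
    then have "x - ?f u - w \<in> Null (p ^ n)"
      using u(1) by (simp add: ev_lin_diff)
    moreover have "x = (x - ?f u - w) + ?f u + w" by simp
    ultimately show ?thesis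
      using w(1) by blast
  qed
  then show ?thesis
    using small_Null_power[OF assms] W(1) unfolding decomposes_def by blast
qed

text \<open>Applying \<open>p ^ n\<close> to a splitting kills the kernel part. The bound on
  \<open>n\<close> gives \<open>Null p \<subseteq> Null (p ^ n)\<close> and
  \<open>Suc n \<le> n + n\<close>.\<close>

lemma decomposes_imp_stabilizes:
  assumes dec: "decomposes (p ^ n)" and n: "n \<ge> 1"
  shows "stabilizes p n"
  unfolding stabilizes_def
proof
  have "Null p \<inter> Range (p ^ n) \<subseteq> Null (p ^ n) \<inter> Range (p ^ n)"
    using Null_power_mono[OF n, of p] by auto
  then show "small (Null p \<inter> Range (p ^ n))"
    using dec small_subset unfolding decomposes_def by blast
  obtain G where G: "small G"
    "\<And>x. \<exists>a\<in>Null (p ^ n). \<exists>b\<in>Range (p ^ n). \<exists>g\<in>G. x = a + b + g"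
    using dec unfolding decomposes_def by blast
  have "\<exists>b\<in>Range (p ^ Suc n). \<exists>g\<in>ev (p ^ n) ` G. x = b + g" if x: "x \<in> Range (p ^ n)" for x
  proof -
    obtain y where y: "x = ev (p ^ n) y"
      using x by blast
    obtain a u g where "a \<in> Null (p ^ n)" "g \<in> G" "y = a + ev (p ^ n) u + g"
      using G(2) by blast
    then have "x = ev (p ^ (n + n)) u + ev (p ^ n) g"
      unfolding y by (simp add: ev_lin_add power_add ev_mult)
    moreover have "ev (p ^ (n + n)) u \<in> Range (p ^ Suc n)"
      using Range_power_antimono[of "Suc n" "n + n" p] n by auto
    ultimately show ?thesis
      using \<open>g \<in> G\<close> by blast
  qed
  then show "\<exists>G. small G \<and> (\<forall>x\<in>Range (p ^ n). \<exists>b\<in>Range (p ^ Suc n). \<exists>g\<in>G. x = b + g)"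
    using small_image[OF clinear_ev G(1)] by blast
qed

text \<open>Monotonicity is inherited from \<open>stabilizes\<close>, which is equivalent at
  positive exponents.\<close>

lemma decomposes_mono:
  assumes "decomposes (p ^ n)" "1 \<le> n" "n \<le> m"
  shows "decomposes (p ^ m)"
  using assms decomposes_imp_stabilizes stabilizes_mono stabilizes_imp_decomposes by blast

lemma eventually_decomposes_iff: "eventually_decomposes p \<longleftrightarrow> (\<exists>n. stabilizes p n)"
proof
  assume "\<exists>n. stabilizes p n"
  then obtain n where "stabilizes p n" by blast
  then have "stabilizes p (Suc n)" by (rule stabilizes_Suc)
  then show "eventually_decomposes p"
    unfolding eventually_decomposes_def
    by (intro exI[of _ "Suc n"]) (auto intro!: stabilizes_imp_decomposes simp del: power_Suc)
next
  assume "eventually_decomposes p"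
  then show "\<exists>n. stabilizes p n"
    unfolding eventually_decomposes_def using decomposes_imp_stabilizes by blast
qed

lemma eventually_decomposes_power:
  assumes "k \<ge> 1"
  shows "eventually_decomposes (p ^ k) \<longleftrightarrow> eventually_decomposes p"
proof
  assume "eventually_decomposes (p ^ k)"
  then obtain n where "n \<ge> 1" "decomposes (p ^ (k * n))"
    unfolding eventually_decomposes_def by (auto simp: power_mult)
  then show "eventually_decomposes p"
    using assms unfolding eventually_decomposes_def by (intro exI[of _ "k * n"]) auto
next
  assume "eventually_decomposes p"
  then obtain n where n: "n \<ge> 1" "decomposes (p ^ n)"
    unfolding eventually_decomposes_def by auto
  then have "decomposes (p ^ (k * n))"
    using decomposes_mono assms by simp
  then show "eventually_decomposes (p ^ k)"
    using n(1) unfolding eventually_decomposes_def by (auto simp: power_mult)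
qed

text \<open>Powers of coprime polynomials stay coprime, and monotonicity brings both factors to a
  common exponent.\<close>

lemma eventually_decomposes_mult:
  assumes "coprime p q"
  shows "eventually_decomposes (p * q) \<longleftrightarrow> eventually_decomposes p \<and> eventually_decomposes q"
proof
  assume "eventually_decomposes (p * q)"
  then obtain n where n: "n \<ge> 1" "decomposes (p ^ n * q ^ n)"
    unfolding eventually_decomposes_def by (auto simp: power_mult_distrib)
  have "coprime (p ^ n) (q ^ n)" "coprime (q ^ n) (p ^ n)"
    using assms by (auto simp: coprime_commute)
  then show "eventually_decomposes p \<and> eventually_decomposes q"
    using n decomposes_multD unfolding eventually_decomposes_def by (metis mult.commute)
next
  assume "eventually_decomposes p \<and> eventually_decomposes q"
  then obtain m n where mn: "m \<ge> 1" "decomposes (p ^ m)" "n \<ge> 1" "decomposes (q ^ n)"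
    unfolding eventually_decomposes_def by blast
  let ?k = "max m n"
  have "decomposes (p ^ ?k * q ^ ?k)"
    using assms mn by (intro decomposes_multI) (auto intro: decomposes_mono)
  then show "eventually_decomposes (p * q)"
    using mn(1) unfolding eventually_decomposes_def
    by (intro exI[of _ ?k]) (auto simp: power_mult_distrib)
qed

lemma eventually_decomposes_const:
  assumes "c \<noteq> 0"
  shows "eventually_decomposes [:c:]"
proof -
  have ev: "ev [:c:] x = c *\<^sub>C x" for x
    by (simp add: ev_pCons)
  have "x = ev [:c:] ((1 / c) *\<^sub>C x)" for x
    using assms by (simp add: ev)
  then have "Range [:c:] = UNIV" by blast
  moreover have "Null [:c:] = {0}"
    using assms by (auto simp: ev)
  ultimately have "decomposes ([:c:] ^ 1)"
    using small_zero unfolding decomposes_def by (auto intro!: exI[of _ "{0}"])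
  then show ?thesis
    unfolding eventually_decomposes_def by blast
qed

end

section \<open>Closed ranges\<close>

lemma Baire_interior_nonempty:
  fixes F :: "nat \<Rightarrow> 'a::{complete_space} set"
  assumes "\<And>n. closed (F n)" "(\<Union>n. F n) = UNIV"
  shows "\<exists>n. interior (F n) \<noteq> {}"
proof (rule ccontr)
  assume none: "\<nexists>n. interior (F n) \<noteq> {}"
  have "Met_TC.mtopology interior_of \<Union>(range F) = {}"
  proof (rule Met_TC.metric_Baire_category_alt)
    show "Met_TC.mcomplete TYPE('a)"
      by (simp add: complete_UNIV)
    show "closedin Met_TC.mtopology T \<and> Met_TC.mtopology interior_of T = {}" if "T \<in> range F" for T
      using that assms(1) none by auto
  qed simp
  then show False
    using assms(2) by simp
qed

text \<open>By Baire, the closure of the image of some ball of \<open>S\<close> has interior points.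
  Centring and scaling solve \<open>f x = y\<close> up to half the norm of \<open>y\<close> with
  control of \<open>norm x\<close>, and iterating on the residual gives an exact solution. Being
  real-linear, the statement also covers the product space used later.\<close>

lemma open_mapping_bound:
  fixes f :: "'b::banach \<Rightarrow> 'a::banach"
  assumes f: "bounded_linear f" and S: "subspace S" "closed S" and surj: "f ` S = UNIV"
  obtains K where "\<And>y. \<exists>x\<in>S. f x = y \<and> norm x \<le> K * norm y"
proof -
  interpret f: bounded_linear f by fact
  define C where "C n = closure (f ` (S \<inter> cball 0 (real n)))" for n
  have "(\<Union>n. C n) = UNIV"
  proof (intro set_eqI iffI UNIV_I)
    fix y
    obtain x where x: "x \<in> S" "y = f x"
      using surj by blast
    obtain n where "norm x \<le> real n"
      using real_arch_simple by blast
    then have "y \<in> C n"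
      unfolding C_def using x closure_subset by fastforce
    then show "y \<in> (\<Union>n. C n)" by blast
  qed
  moreover have "closed (C n)" for n
    by (simp add: C_def)
  ultimately obtain n where "interior (C n) \<noteq> {}"
    using Baire_interior_nonempty by metis
  then obtain y0 r where r: "r > 0" "ball y0 r \<subseteq> C n"
    by (metis equals0I mem_interior)
  have near: "\<exists>x\<in>S. norm x \<le> real n \<and> norm (y - f x) < e" if y: "norm y < r" and e: "e > 0" for y e
  proof -
    have "y0 + y \<in> C n" "y0 - y \<in> C n"
      using r(2) y by (auto simp: subset_iff dist_norm)
    then obtain u v where u: "u \<in> S" "norm u \<le> real n" "dist (f u) (y0 + y) < e"
      and v: "v \<in> S" "norm v \<le> real n" "dist (f v) (y0 - y) < e"
      unfolding C_def closure_approachable using e by (fastforce simp: image_iff)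
    \<comment> \<open>Half the difference cancels the centre \<open>y0\<close> and keeps the norm
      bound.\<close>
    let ?x = "(1/2) *\<^sub>R (u - v)"
    have "?x \<in> S"
      using u(1) v(1) S(1) by (intro subspace_mul subspace_diff)
    moreover have "norm ?x \<le> real n"
      using norm_triangle_ineq4[of u v] u(2) v(2) by simp
    moreover have "y - f ?x = (1/2) *\<^sub>R ((f v - (y0 - y)) - (f u - (y0 + y)))"
      by (simp add: f.scaleR f.diff algebra_simps flip: scaleR_add_left)
    then have "norm (y - f ?x) < e"
      using norm_triangle_ineq4[of "f v - (y0 - y)" "f u - (y0 + y)"] u(3) v(3)
      by (simp add: dist_norm)
    ultimately show ?thesis by blast
  qed
  \<comment> \<open>A non-zero \<open>y\<close> is rescaled to norm \<open>r / 2\<close> and solved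
    up to an error below \<open>r / 4\<close>, half that norm; undoing the scaling turns the bound
    \<open>real n\<close> into \<open>K * norm y\<close>.\<close>
  define K where "K = 2 * real n / r"
  have "\<exists>x\<in>S. norm x \<le> K * norm y \<and> norm (y - f x) \<le> norm y / 2" for y
  proof (cases "y = 0")
    case True
    then show ?thesis
      using S(1) by (intro bexI[of _ 0]) (auto simp: subspace_0 f.zero)
  next
    case False
    define t where "t = r / (2 * norm y)"
    have t: "t > 0" "t * norm y = r / 2"
      using r(1) False by (simp_all add: t_def)
    obtain x where x: "x \<in> S" "norm x \<le> real n" "norm (t *\<^sub>R y - f x) < r / 4"
      using near[of "t *\<^sub>R y" "r / 4"] r(1) t by auto
    let ?x = "(1/t) *\<^sub>R x"
    have "?x \<in> S"
      using x(1) S(1) by (rule subspace_mul[rotated])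
    moreover have "norm ?x \<le> K * norm y"
      using x(2) t(1) r(1) False by (simp add: K_def t_def field_simps)
    moreover have "t *\<^sub>R (y - f ?x) = t *\<^sub>R y - f x"
      using t(1) by (simp add: f.scaleR scaleR_diff_right)
    then have "t * norm (y - f ?x) = norm (t *\<^sub>R y - f x)"
      using t(1) norm_scaleR[of t "y - f ?x"] by simp
    then have "t * norm (y - f ?x) \<le> t * (norm y / 2)"
      using x(3) t(2) by simp
    then have "norm (y - f ?x) \<le> norm y / 2"
      using t(1) mult_le_cancel_left_pos by blast
    ultimately show ?thesis by blast
  qed
  then obtain g where g: "\<And>y. g y \<in> S" "\<And>y. norm (g y) \<le> K * norm y"
    "\<And>y. norm (y - f (g y)) \<le> norm y / 2"
    by metis
  have K: "K \<ge> 0"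
    using r(1) by (simp add: K_def)
  show thesis
  proof (rule that[of "2 * K"])
    fix y
    \<comment> \<open>\<open>s k\<close> is the residual after \<open>k\<close> corrections. Its
      norm at least halves each time, so the corrections sum to norm at most
      \<open>2 * K * norm y\<close>.\<close>
    define s where "s = rec_nat y (\<lambda>_ z. z - f (g z))"
    have s0: "s 0 = y" and sS: "s (Suc k) = s k - f (g (s k))" for k
      by (simp_all add: s_def)
    have norm_s: "norm (s k) \<le> norm y * (1/2) ^ k" for k
    proof (induction k)
      case (Suc k)
      then show ?case
        using g(3)[of "s k"] by (simp add: sS)
    qed (simp add: s0)
    have bound: "norm (g (s k)) \<le> K * norm y * (1/2) ^ k" for k
      using order.trans[OF g(2)[of "s k"] mult_left_mono[OF norm_s[of k] K]] by (simp add: mult.assoc)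
    have geo: "(\<lambda>k. K * norm y * (1/2) ^ k) sums (2 * K * norm y)"
      using sums_mult[OF geometric_sums[of "1/2 :: real"], of "K * norm y"] by (simp add: mult_ac)
    have "summable (\<lambda>k. norm (g (s k)))"
      using bound by (intro summable_comparison_test'[OF sums_summable[OF geo], of 0]) auto
    then have sums: "(\<lambda>k. g (s k)) sums (\<Sum>k. g (s k))"
      by (rule summable_sums[OF summable_norm_cancel])
    let ?x = "\<Sum>k. g (s k)"
    have "(\<Sum>k<m. g (s k)) \<in> S" for m
      using g(1) S(1) by (intro subspace_sum) auto
    then have "?x \<in> S"
      by (rule closed_sequentially[OF S(2) _ sums[unfolded sums_def]])
    moreover have "(\<lambda>k. s k - s (Suc k)) sums (s 0 - 0)"
    proof (rule telescope_sums')
      show "s \<longlonglongrightarrow> 0"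
      proof (rule Lim_null_comparison)
        show "(\<lambda>k. norm y * (1/2) ^ k) \<longlonglongrightarrow> 0"
          by (intro tendsto_mult_right_zero LIMSEQ_realpow_zero) auto
      qed (use norm_s in auto)
    qed
    then have "(\<lambda>k. f (g (s k))) sums y"
      by (simp add: sS s0)
    then have "f ?x = y"
      using f.sums[OF sums] sums_unique2 by blast
    moreover have "norm ?x \<le> 2 * K * norm y"
      using norm_suminf_le[OF bound sums_summable[OF geo]] sums_unique[OF geo] by simp
    ultimately show "\<exists>x\<in>S. f x = y \<and> norm x \<le> 2 * K * norm y" by blast
  qed
qed

section \<open>Sums of a closed subspace with finitely many directions\<close>

lemma bounded_linear_scaleC_left: "bounded_linear (\<lambda>c. c *\<^sub>C (x::'a::complex_banach))"
  by (rule bounded_linear_intro[where K = "norm x"])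
    (simp_all add: scaleC_add_left scaleR_scaleC[where 'a = 'a] norm_scaleC scaleR_conv_of_real)

lemma csubspace_imp_subspace: "csubspace S \<Longrightarrow> subspace S"
  by (auto simp: subspace_def complex_vector.subspace_def scaleR_scaleC)

text \<open>If \<open>v\<close> is outside \<open>M\<close>, its positive distance \<open>d\<close>
  to \<open>M\<close> bounds the coefficient of \<open>v\<close>. Along a convergent sequence the
  coefficients are therefore Cauchy, and the parts in \<open>M\<close> converge too.\<close>

lemma closed_add_line:
  fixes M :: "'a::complex_banach set"
  assumes M: "csubspace M" "closed M"
  shows "closed {x + c *\<^sub>C v |x c. x \<in> M}"
proof (cases "v \<in> M")
  case True
  have "{x + c *\<^sub>C v |x c. x \<in> M} = M"
  proof (intro equalityI subsetI)
    show "x \<in> {x + c *\<^sub>C v |x c. x \<in> M}" if "x \<in> M" for x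
      using that by (intro CollectI exI[of _ x] exI[of _ 0]) simp
  qed (use True M(1) complex_vector.subspace_add complex_vector.subspace_scale in blast)
  then show ?thesis
    using M(2) by simp
next
  case False
  define d where "d = infdist v M"
  have "M \<noteq> {}"
    using complex_vector.subspace_0[OF M(1)] by auto
  then have d: "d > 0" "\<And>x. x \<in> M \<Longrightarrow> d \<le> dist v x"
    using infdist_pos_not_in_closed[OF M(2) _ False] infdist_le by (auto simp: d_def)
  have bound: "d * cmod c \<le> norm (x + c *\<^sub>C v)" if x: "x \<in> M" for x c
  proof (cases "c = 0")
    case c: False
    have "x + c *\<^sub>C v = c *\<^sub>C (v - (- 1 / c) *\<^sub>C x)"
      using c by (simp add: scaleC_add_right)
    moreover have "d \<le> norm (v - (- 1 / c) *\<^sub>C x)"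
      using d(2)[OF complex_vector.subspace_scale[OF M(1) x], of "- 1 / c"] by (simp only: dist_norm)
    ultimately show ?thesis
      by (metis mult.commute mult_left_mono norm_ge_zero norm_scaleC)
  qed simp
  show ?thesis
    unfolding closed_sequential_limits
  proof (intro allI impI, elim conjE)
    fix s l
    assume "\<forall>n. s n \<in> {x + c *\<^sub>C v |x c. x \<in> M}" and l: "s \<longlonglongrightarrow> l"
    then obtain x c where s: "\<And>n. s n = x n + c n *\<^sub>C v" "\<And>n. x n \<in> M"
      by simp metis
    have "Cauchy c"
    proof (rule metric_CauchyI)
      fix e :: real assume "e > 0"
      then have "d * e > 0"
        using d(1) by simp
      then obtain N where N: "\<And>m n. m \<ge> N \<Longrightarrow> n \<ge> N \<Longrightarrow> dist (s m) (s n) < d * e"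
        using LIMSEQ_imp_Cauchy[OF l] metric_CauchyD by blast
      have "dist (c m) (c n) < e" if "m \<ge> N" "n \<ge> N" for m n
      proof -
        have "s m - s n = (x m - x n) + (c m - c n) *\<^sub>C v"
          by (simp add: s complex_vector.scale_left_diff_distrib)
        moreover have "x m - x n \<in> M"
          using s(2) M(1) complex_vector.subspace_diff by blast
        ultimately have "d * dist (c m) (c n) \<le> dist (s m) (s n)"
          using bound[of "x m - x n" "c m - c n"] by (simp add: dist_norm)
        then have "d * dist (c m) (c n) < d * e"
          using N[OF that] by linarith
        then show ?thesis
          using d(1) by simp
      qed
      then show "\<exists>N. \<forall>m\<ge>N. \<forall>n\<ge>N. dist (c m) (c n) < e" by blast
    qed
    then obtain c0 where "c \<longlonglongrightarrow> c0"
      using Cauchy_convergent convergentD by blast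
    then have "(\<lambda>n. s n - c n *\<^sub>C v) \<longlonglongrightarrow> l - c0 *\<^sub>C v"
      by (intro tendsto_diff l bounded_linear.tendsto[OF bounded_linear_scaleC_left])
    then have "x \<longlonglongrightarrow> l - c0 *\<^sub>C v"
      by (simp add: s)
    then have "l - c0 *\<^sub>C v \<in> M"
      using M(2) s(2) unfolding closed_sequential_limits by blast
    then show "l \<in> {x + c *\<^sub>C v |x c. x \<in> M}"
      by (intro CollectI exI[of _ "l - c0 *\<^sub>C v"] exI[of _ c0]) simp
  qed
qed

lemma add_span_insert:
  "{x + y |x y. x \<in> M \<and> y \<in> cspan (insert v B)} =
    {z + c *\<^sub>C v |z c. z \<in> {x + y |x y. x \<in> M \<and> y \<in> cspan B}}"
proof (intro equalityI subsetI)
  fix z assume "z \<in> {x + y |x y. x \<in> M \<and> y \<in> cspan (insert v B)}"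
  then obtain x y c where "z = x + y" "x \<in> M" "y - c *\<^sub>C v \<in> cspan B"
    by (auto simp: complex_vector.span_insert)
  moreover from this have "z = (x + (y - c *\<^sub>C v)) + c *\<^sub>C v" by simp
  ultimately show "z \<in> {z + c *\<^sub>C v |z c. z \<in> {x + y |x y. x \<in> M \<and> y \<in> cspan B}}"
    by blast
next
  fix z assume "z \<in> {z + c *\<^sub>C v |z c. z \<in> {x + y |x y. x \<in> M \<and> y \<in> cspan B}}"
  then obtain x y c where z: "z = (x + y) + c *\<^sub>C v" "x \<in> M" "y \<in> cspan B"
    by blast
  then have "y + c *\<^sub>C v \<in> cspan (insert v B)"
    by (auto simp: complex_vector.span_insert intro!: exI[of _ c])
  then show "z \<in> {x + y |x y. x \<in> M \<and> y \<in> cspan (insert v B)}"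
    using z by (intro CollectI exI[of _ x] exI[of _ "y + c *\<^sub>C v"]) (simp add: add.assoc)
qed

lemma csubspace_add_span:
  assumes "csubspace M"
  shows "csubspace {x + y |x y. x \<in> M \<and> y \<in> cspan B}"
  using complex_vector.subspace_sums[OF assms complex_vector.subspace_span] .

lemma closed_add_span:
  fixes M :: "'a::complex_banach set"
  assumes "csubspace M" "closed M" "finite B"
  shows "closed {x + y |x y. x \<in> M \<and> y \<in> cspan B}"
  using assms(3)
proof induction
  case empty
  then show ?case
    using assms(2) by simp
next
  case (insert v B)
  then show ?case
    unfolding add_span_insert by (intro closed_add_line csubspace_add_span assms(1))
qed

lemma closed_finite_dim_subspace:
  fixes S :: "'a::complex_banach set"
  assumes "csubspace S" "finite_dim S"
  shows "closed S"
proof -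
  obtain B where B: "finite B" "B \<subseteq> S" "S \<subseteq> cspan B"
    using assms(2) unfolding finite_dim_def by blast
  then have "S = {x + y |x y. x \<in> {0} \<and> y \<in> cspan B}"
    using complex_vector.span_minimal[OF B(2) assms(1)] by auto
  then show ?thesis
    using closed_add_span[of "{0}" B] B(1) by simp
qed

text \<open>Each new direction adds at most one dimension to the intersection.\<close>

lemma finite_dim_add_span_Int:
  assumes M: "csubspace M" and V: "csubspace V" and fd: "finite_dim (M \<inter> V)" and B: "finite B"
  shows "finite_dim ({x + y |x y. x \<in> M \<and> y \<in> cspan B} \<inter> V)"
  using B
proof induction
  case empty
  then show ?case
    using fd by simp
next
  case (insert v B)
  let ?S = "{x + y |x y. x \<in> M \<and> y \<in> cspan B}"
  have S: "csubspace ?S"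
    using M by (rule csubspace_add_span)
  show ?case
  proof (cases "{z + c *\<^sub>C v |z c. z \<in> ?S} \<inter> V \<subseteq> ?S")
    case True
    then show ?thesis
      unfolding add_span_insert by (intro finite_dim_subset[OF insert.IH] Int_greatest) auto
  next
    case False
    then obtain z c where z: "z \<in> ?S" "z + c *\<^sub>C v \<in> V" "z + c *\<^sub>C v \<notin> ?S"
      by blast
    then have c: "c \<noteq> 0" by auto
    \<comment> \<open>\<open>w\<close> lies in \<open>V\<close> and has a non-zero coefficient at
      \<open>v\<close>; subtracting a multiple of it removes \<open>v\<close> from any other vector
      of the intersection without leaving \<open>V\<close>.\<close>
    define w where "w = z + c *\<^sub>C v"
    have "{z + c *\<^sub>C v |z c. z \<in> ?S} \<inter> V \<subseteq> {x + y |x y. x \<in> ?S \<inter> V \<and> y \<in> cspan {w}}"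
    proof
      fix u assume "u \<in> {z + c *\<^sub>C v |z c. z \<in> ?S} \<inter> V"
      then obtain z' c' where u: "u \<in> V" "z' \<in> ?S" "u = z' + c' *\<^sub>C v"
        by blast
      have "u - (c' / c) *\<^sub>C w = z' - (c' / c) *\<^sub>C z"
        using c by (simp add: u(3) w_def complex_vector.scale_right_distrib)
      also have "\<dots> \<in> ?S"
        by (intro complex_vector.subspace_diff[OF S] complex_vector.subspace_scale[OF S] u(2) z(1))
      finally have "u - (c' / c) *\<^sub>C w \<in> ?S" .
      moreover have "u - (c' / c) *\<^sub>C w \<in> V"
        unfolding w_def
        by (intro complex_vector.subspace_diff[OF V] complex_vector.subspace_scale[OF V] u(1) z(2))
      moreover have "(c' / c) *\<^sub>C w \<in> cspan {w}"
        by (simp add: complex_vector.span_base complex_vector.span_scale)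
      moreover have "u = (u - (c' / c) *\<^sub>C w) + (c' / c) *\<^sub>C w" by simp
      ultimately show "u \<in> {x + y |x y. x \<in> ?S \<inter> V \<and> y \<in> cspan {w}}"
        by (intro CollectI exI[of _ "u - (c' / c) *\<^sub>C w"] exI[of _ "(c' / c) *\<^sub>C w"]) simp
    qed
    then show ?thesis
      unfolding add_span_insert[of M v B]
      by (rule finite_dim_subset[OF finite_dim_sum[OF insert.IH], rotated])
        (unfold finite_dim_iff, intro exI[of _ "{w}"], simp)
  qed
qed

text \<open>
  By the open mapping theorem \<open>y = f u + w\<close> can be solved with \<open>w\<close> bounded by a multiple of \<open>norm y\<close>.
  Solving this also for the differences \<open>y - s\<^sub>n\<close>, where \<open>s\<^sub>n \<in> range f\<close> tends to \<open>y\<close>, exhibits \<open>w\<close> as a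
  limit of vectors in \<open>W \<inter> range f\<close>.
\<close>

lemma closed_range_complement:
  fixes f :: "'a::complex_banach \<Rightarrow> 'a"
  assumes f: "bounded_linear f" and W: "csubspace W" "closed W"
    and int: "closed (W \<inter> range f)" and sum: "\<And>y. \<exists>u. \<exists>w\<in>W. y = f u + w"
  shows "closed (range f)"
proof -
  interpret f: bounded_linear f by fact
  define L where "L = (\<lambda>p. f (fst p) + snd p)"
  have "bounded_linear L"
    unfolding L_def by (intro bounded_linear_intros f.bounded_linear bounded_linear_compose[OF f])
  moreover have "subspace (UNIV \<times> W)"
    using csubspace_imp_subspace[OF W(1)] by (simp add: subspace_Times)
  moreover have "closed ((UNIV :: 'a set) \<times> W)"
    using W(2) by (intro closed_Times) auto
  moreover have "L ` (UNIV \<times> W) = UNIV"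
    using sum by (force simp: L_def image_iff)
  ultimately obtain K where K: "\<And>y. \<exists>p\<in>UNIV \<times> W. L p = y \<and> norm p \<le> K * norm y"
    using open_mapping_bound by metis
  have "\<exists>p. snd p \<in> W \<and> f (fst p) + snd p = y \<and> norm (snd p) \<le> K * norm y" for y
  proof -
    obtain p where p: "snd p \<in> W" "f (fst p) + snd p = y" "norm p \<le> K * norm y"
      using K[of y] by (auto simp: L_def)
    then have "norm (snd p) \<le> K * norm y"
      using norm_snd_le[of "snd p" "fst p"] by simp
    then show ?thesis
      using p by blast
  qed
  then obtain q where q: "\<And>y. snd (q y) \<in> W \<and> f (fst (q y)) + snd (q y) = y \<and>
      norm (snd (q y)) \<le> K * norm y"
    using choice[of "\<lambda>y p. snd p \<in> W \<and> f (fst p) + snd p = y \<and> norm (snd p) \<le> K * norm y"]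
    by auto
  define U where "U = fst \<circ> q"
  define V where "V = snd \<circ> q"
  have UV: "V y \<in> W" "f (U y) + V y = y" "norm (V y) \<le> K * norm y" for y
    using q[of y] by (simp_all add: U_def V_def)
  show ?thesis
    unfolding closed_sequential_limits
  proof (intro allI impI, elim conjE)
    fix s y
    assume "\<forall>n. s n \<in> range f" and y: "s \<longlonglongrightarrow> y"
    then obtain x where s: "s n = f (x n)" for n
      using choice[of "\<lambda>n u. s n = f u"] by auto
    have "(\<lambda>n. V (y - s n)) \<longlonglongrightarrow> 0"
    proof (rule Lim_null_comparison)
      show "\<forall>\<^sub>F n in sequentially. norm (V (y - s n)) \<le> K * norm (y - s n)"
        using UV(3) by simp
      have "(\<lambda>n. K * norm (y - s n)) \<longlonglongrightarrow> K * norm (y - y)"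
        by (intro tendsto_intros y)
      then show "(\<lambda>n. K * norm (y - s n)) \<longlonglongrightarrow> 0" by simp
    qed
    then have "(\<lambda>n. V y - V (y - s n)) \<longlonglongrightarrow> V y - 0"
      by (intro tendsto_intros)
    moreover have "V y - V (y - s n) \<in> W \<inter> range f" for n
    proof -
      have "V y - V (y - s n) = (y - f (U y)) - ((y - s n) - f (U (y - s n)))"
        using UV(2)[of y] UV(2)[of "y - s n"] by (simp add: algebra_simps)
      also have "\<dots> = f (x n - U y + U (y - s n))"
        by (simp add: s f.add f.diff)
      finally show ?thesis
        using UV(1) W(1) complex_vector.subspace_diff by blast
    qed
    ultimately have "V y \<in> W \<inter> range f"
      using closed_sequentially[OF int, of "\<lambda>n. V y - V (y - s n)" "V y"] by simp
    then obtain z where "V y = f z" by blast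
    then have "y = f (U y + z)"
      using UV(2)[of y] by (simp add: f.add)
    then show "y \<in> range f" by blast
  qed
qed

sublocale bounded_op \<subseteq> fredholm: small_bounded_op finite_dim R ..

sublocale bounded_op \<subseteq> drazin: small_bounded_op "\<lambda>S. S \<subseteq> {0}" R ..

context bounded_op
begin

lemma closed_Null: "closed (Null p)"
proof -
  have "continuous_on UNIV (ev p)"
    by (rule linear_continuous_on[OF bounded_linear_ev])
  then show ?thesis
    using continuous_closed_vimage[of "{0}" "ev p"] by (simp add: vimage_def continuous_on_eq_continuous_at)
qed

text \<open>\<open>closed_range_complement\<close> does not ask for a true complement:
  \<open>Null p\<close> plus a finite-dimensional error space is closed, completes
  \<open>Range p\<close> to the whole space and meets it in finite dimension.\<close>

lemma closed_Range:
  assumes "fredholm.decomposes p"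
  shows "closed (Range p)"
proof -
  obtain G where fd: "finite_dim (Null p \<inter> Range p)" and "finite_dim G"
    and G: "\<And>x. \<exists>a\<in>Null p. \<exists>b\<in>Range p. \<exists>g\<in>G. x = a + b + g"
    using assms unfolding fredholm.decomposes_def by metis
  then obtain B where B: "finite B" "G \<subseteq> cspan B"
    unfolding finite_dim_iff by blast
  let ?W = "{x + y |x y. x \<in> Null p \<and> y \<in> cspan B}"
  show ?thesis
  proof (rule closed_range_complement[OF bounded_linear_ev])
    show "csubspace ?W"
      using subspace_Null by (rule csubspace_add_span)
    show "closed ?W"
      by (rule closed_add_span[OF subspace_Null closed_Null B(1)])
    show "closed (?W \<inter> Range p)"
      by (intro closed_finite_dim_subspace finite_dim_add_span_Int complex_vector.subspace_inter
          csubspace_add_span subspace_Null subspace_Range fd B(1))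
    fix y
    obtain a b g where y: "a \<in> Null p" "b \<in> Range p" "g \<in> G" "y = a + b + g"
      using G by blast
    then obtain u where "b = ev p u" by blast
    then have "y = ev p u + (a + g)" "a + g \<in> ?W"
      using y B(2) by (auto simp: algebra_simps)
    then show "\<exists>u. \<exists>w\<in>?W. y = ev p u + w" by blast
  qed
qed

end

section \<open>Homogenised polynomials\<close>

text \<open>
  Substituting \<open>\<mu> + 1 / z\<close> for the variable and clearing denominators; with \<open>R = (A - \<mu>)\<inverse>\<close> this
  turns \<open>Q(A)\<close> into \<open>(hom_poly \<mu> Q)(R) R\<^sup>-\<^sup>m\<close>, where \<open>m = degree Q\<close>.
\<close>

definition hom_poly :: "complex \<Rightarrow> complex poly \<Rightarrow> complex poly"
  where "hom_poly \<mu> Q =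
    (\<Sum>k\<le>degree Q. smult (coeff Q k) ([:1, \<mu>:] ^ k * [:0, 1:] ^ (degree Q - k)))"

lemma poly_hom_poly:
  assumes "z \<noteq> 0"
  shows "poly (hom_poly \<mu> Q) z = z ^ degree Q * poly Q (\<mu> + 1 / z)"
proof -
  have *: "(1 + z * \<mu>) ^ k * z ^ (degree Q - k) = z ^ degree Q * (\<mu> + 1 / z) ^ k"
    if "k \<le> degree Q" for k
  proof -
    have "1 + z * \<mu> = z * (\<mu> + 1 / z)"
      using assms by (simp add: distrib_left add.commute)
    then have "(1 + z * \<mu>) ^ k * z ^ (degree Q - k) = (\<mu> + 1 / z) ^ k * (z ^ k * z ^ (degree Q - k))"
      by (simp add: power_mult_distrib mult_ac)
    also have "z ^ k * z ^ (degree Q - k) = z ^ degree Q"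
      using that by (simp flip: power_add)
    finally show ?thesis
      by (simp add: mult.commute)
  qed
  show ?thesis
    unfolding hom_poly_def poly_sum poly_altdef[of Q] sum_distrib_left
    by (intro sum.cong) (simp_all add: *)
qed

text \<open>Only the leading term is free of the factor \<open>[:0, 1:]\<close>. For
  \<open>Q \<noteq> 0\<close> the value is non-zero, which makes \<open>hom_poly \<mu> Q\<close>
  coprime to the variable.\<close>

lemma poly_hom_poly_0: "poly (hom_poly \<mu> Q) 0 = lead_coeff Q"
proof -
  have "poly (hom_poly \<mu> Q) 0 = (\<Sum>k\<le>degree Q. if k = degree Q then coeff Q k else 0)"
    unfolding hom_poly_def poly_sum by (intro sum.cong) (auto simp: poly_power)
  then show ?thesis by simp
qed

lemma hom_poly_mult:
  assumes "P \<noteq> 0" "Q \<noteq> 0"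
  shows "hom_poly \<mu> (P * Q) = hom_poly \<mu> P * hom_poly \<mu> Q"
proof -
  \<comment> \<open>The extra factor \<open>[:0, 1:]\<close> takes care of \<open>z = 0\<close>,
    which \<open>poly_hom_poly\<close> excludes.\<close>
  have "poly ([:0, 1:] * (hom_poly \<mu> (P * Q) - hom_poly \<mu> P * hom_poly \<mu> Q)) z = 0" for z
    using assms
    by (cases "z = 0") (simp_all add: poly_hom_poly degree_mult_eq power_add mult_ac)
  then have "[:0, 1:] * (hom_poly \<mu> (P * Q) - hom_poly \<mu> P * hom_poly \<mu> Q) = 0"
    using poly_all_0_iff_0 by blast
  then show ?thesis by simp
qed

lemma hom_poly_const: "hom_poly \<mu> [:c:] = [:c:]"
  by (simp add: hom_poly_def)

lemma hom_poly_linear: "hom_poly \<mu> [:- \<zeta>, 1:] = [:1, \<mu> - \<zeta>:]"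
  by (simp add: hom_poly_def)

lemma hom_poly_power:
  assumes "P \<noteq> 0"
  shows "hom_poly \<mu> (P ^ n) = hom_poly \<mu> P ^ n"
  using assms hom_poly_const[of \<mu> 1]
  by (induction n) (simp_all add: hom_poly_mult one_pCons)

lemma coprime_X:
  fixes p :: "complex poly"
  assumes "poly p 0 \<noteq> 0"
  shows "coprime p [:0, 1:]"
proof -
  have "\<not> [:0, 1:] dvd p"
    using assms poly_eq_0_iff_dvd[of p 0] by simp
  then show ?thesis
    using prime_elem_imp_coprime[OF prime_elem_linear_field_poly[of 1 0]] coprime_commute by auto
qed

text \<open>The linear factor becomes 1 if \<open>\<mu> = \<zeta>\<close>. Otherwise it is prime,
  and its root \<open>z\<close> satisfies \<open>\<mu> + 1 / z = \<zeta>\<close>, so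
  \<open>hom_poly \<mu> Q\<close> does not vanish there.\<close>

lemma coprime_hom_poly_linear:
  assumes "poly Q \<zeta> \<noteq> 0"
  shows "coprime (hom_poly \<mu> [:- \<zeta>, 1:]) (hom_poly \<mu> Q)"
proof (cases "\<mu> = \<zeta>")
  case True
  then show ?thesis
    unfolding hom_poly_linear by (simp flip: one_pCons)
next
  case False
  define z where "z = 1 / (\<zeta> - \<mu>)"
  have z: "z \<noteq> 0" "\<mu> + 1 / z = \<zeta>" "poly [:1, \<mu> - \<zeta>:] z = 0"
    using False by (simp_all add: z_def field_simps)
  have "poly (hom_poly \<mu> Q) z \<noteq> 0"
    using z assms by (simp add: poly_hom_poly)
  then have "\<not> [:1, \<mu> - \<zeta>:] dvd hom_poly \<mu> Q"
    using z(3) by (metis dvdE mult_eq_0_iff poly_mult)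
  then show ?thesis
    unfolding hom_poly_linear
    using False prime_elem_linear_field_poly[of "\<mu> - \<zeta>" 1] prime_elem_imp_coprime by auto
qed

context small_bounded_op
begin

lemma eventually_decomposes_hom_poly:
  assumes "Q \<noteq> 0"
  shows "eventually_decomposes (hom_poly \<mu> Q) \<longleftrightarrow>
    (\<forall>\<zeta>. poly Q \<zeta> = 0 \<longrightarrow> eventually_decomposes (hom_poly \<mu> [:- \<zeta>, 1:]))"
  using assms
proof (induction "degree Q" arbitrary: Q rule: less_induct)
  case less
  show ?case
  proof (cases "degree Q = 0")
    case True
    then obtain c where "Q = [:c:]"
      by (rule degree_eq_zeroE)
    then show ?thesis
      using less.prems eventually_decomposes_const[of c] by (simp add: hom_poly_const)
  next
    case False
    then obtain \<zeta> where root: "poly Q \<zeta> = 0"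
      using fundamental_theorem_of_algebra by (metis constant_degree)
    \<comment> \<open>Splitting off the full multiplicity leaves a cofactor that does not vanish at
      \<open>\<zeta>\<close>, hence coprime factors; the exponent \<open>k\<close> itself is
      immaterial by \<open>eventually_decomposes_power\<close>.\<close>
    define k where "k = order \<zeta> Q"
    have k: "k \<ge> 1"
      using root less.prems order_root[of Q \<zeta>] by (simp add: k_def)
    obtain Q' where Q': "Q = [:- \<zeta>, 1:] ^ k * Q'" "\<not> [:- \<zeta>, 1:] dvd Q'"
      using order_decomp[OF less.prems] k_def by blast
    have nz: "Q' \<noteq> 0"
      using Q'(2) by auto
    have "degree Q = k + degree Q'"
      using nz by (simp add: Q'(1) degree_mult_eq degree_linear_power)
    then have IH: "eventually_decomposes (hom_poly \<mu> Q') \<longleftrightarrow>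
        (\<forall>\<zeta>. poly Q' \<zeta> = 0 \<longrightarrow> eventually_decomposes (hom_poly \<mu> [:- \<zeta>, 1:]))"
      using less.hyps[of Q'] nz k by simp
    have "poly Q' \<zeta> \<noteq> 0"
      using Q'(2) poly_eq_0_iff_dvd by blast
    then have "coprime (hom_poly \<mu> [:- \<zeta>, 1:] ^ k) (hom_poly \<mu> Q')"
      using coprime_hom_poly_linear by simp
    moreover have "hom_poly \<mu> Q = hom_poly \<mu> [:- \<zeta>, 1:] ^ k * hom_poly \<mu> Q'"
      using nz by (simp add: Q'(1) hom_poly_mult hom_poly_power)
    ultimately have "eventually_decomposes (hom_poly \<mu> Q) \<longleftrightarrow>
        eventually_decomposes (hom_poly \<mu> [:- \<zeta>, 1:]) \<and> eventually_decomposes (hom_poly \<mu> Q')"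
      using eventually_decomposes_mult eventually_decomposes_power[OF k] by simp
    moreover have "poly Q z = 0 \<longleftrightarrow> z = \<zeta> \<or> poly Q' z = 0" for z
      using k by (auto simp: Q'(1) poly_power)
    ultimately show ?thesis
      using IH by auto
  qed
qed

end

section \<open>Closed operators as fractions of bounded ones\<close>

context bounded_op
begin

text \<open>\<open>T = p(R) R\<^sup>-\<^sup>m\<close>; the injectivity of \<open>R\<close> is implicit in \<open>T\<close> being single-valued.\<close>

definition represents :: "'a operator \<Rightarrow> complex poly \<Rightarrow> nat \<Rightarrow> bool"
  where "represents T p m \<longleftrightarrow> op_dom T = Range ([:0, 1:] ^ m) \<and>
    (\<forall>y. op_app T (ev ([:0, 1:] ^ m) y) = ev p y)"

text \<open>The form in which coprimality to the variable is used: if \<open>ev p x\<close> lies in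
  the range of the \<open>m\<close>-th power of \<open>R\<close>, then so does
  \<open>x\<close>.\<close>

lemma bezout_X:
  assumes "coprime p [:0, 1:]"
  obtains a b where "\<And>x. x = ev ([:0, 1:] ^ m) (ev a x) + ev b (ev p x)"
proof -
  have "coprime p ([:0, 1:] ^ m)"
    using assms by simp
  then obtain b a where "\<And>x. x = ev (b * p) x + ev (a * [:0, 1:] ^ m) x"
    using bezout by metis
  then have "x = ev ([:0, 1:] ^ m) (ev a x) + ev b (ev p x)" for x
    using ev_commute[of a] by (metis add.commute ev_mult)
  then show thesis by (rule that)
qed

text \<open>The point is the domain: \<open>T\<close> applies to \<open>ev (p ^ k) y\<close> when
  this lies in the range of the \<open>m\<close>-th power of \<open>R\<close>, which by
  \<open>bezout_X\<close> means that \<open>y\<close> itself does.\<close>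

lemma represents_power:
  assumes T: "represents T p m" and p: "coprime p [:0, 1:]"
  shows "represents (op_power T k) (p ^ k) (k * m)"
proof (induction k)
  case 0
  have "ev 1 = (\<lambda>x. x)" by (rule ext) simp
  then show ?case
    by (simp add: represents_def)
next
  case (Suc k)
  let ?X = "[:0, 1:] :: complex poly"
  have app: "op_app (op_power T k) (ev (?X ^ (k * m)) y) = ev (p ^ k) y" for y
    using Suc unfolding represents_def by blast
  have X: "ev (?X ^ (Suc k * m)) y = ev (?X ^ (k * m)) (ev (?X ^ m) y)" for y
    by (simp add: power_add mult.commute flip: ev_mult)
  have "{x \<in> Range (?X ^ (k * m)). op_app (op_power T k) x \<in> Range (?X ^ m)} = Range (?X ^ (Suc k * m))"
  proof (intro equalityI subsetI)
    fix x assume "x \<in> {x \<in> Range (?X ^ (k * m)). op_app (op_power T k) x \<in> Range (?X ^ m)}"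
    then obtain y w where y: "x = ev (?X ^ (k * m)) y" "ev (p ^ k) y = ev (?X ^ m) w"
      using app by auto
    obtain a b where "\<And>x. x = ev (?X ^ m) (ev a x) + ev b (ev (p ^ k) x)"
      using bezout_X[of "p ^ k" m] p by auto
    then have "y = ev (?X ^ m) (ev a y) + ev b (ev (p ^ k) y)" by blast
    also have "\<dots> = ev (?X ^ m) (ev a y + ev b w)"
      using ev_commute[of b] by (simp add: y(2) ev_lin_add)
    finally show "x \<in> Range (?X ^ (Suc k * m))"
      using X y(1) by (metis rangeI)
  next
    fix x assume "x \<in> Range (?X ^ (Suc k * m))"
    then obtain y where y: "x = ev (?X ^ (k * m)) (ev (?X ^ m) y)"
      using X by auto
    have "op_app (op_power T k) x = ev (p ^ k) (ev (?X ^ m) y)"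
      unfolding y by (rule app)
    also have "\<dots> = ev (?X ^ m) (ev (p ^ k) y)"
      by (rule ev_commute)
    finally have "op_app (op_power T k) x \<in> Range (?X ^ m)"
      by blast
    then show "x \<in> {x \<in> Range (?X ^ (k * m)). op_app (op_power T k) x \<in> Range (?X ^ m)}"
      using y by auto
  qed
  then have "op_dom (op_power T (Suc k)) = Range (?X ^ (Suc k * m))"
    using Suc T by (simp add: represents_def)
  moreover have "op_app (op_power T (Suc k)) (ev (?X ^ (Suc k * m)) y) = ev (p ^ Suc k) y" for y
  proof -
    have "op_app (op_power T (Suc k)) (ev (?X ^ (Suc k * m)) y) =
        op_app T (op_app (op_power T k) (ev (?X ^ (k * m)) (ev (?X ^ m) y)))"
      unfolding X by simp
    also have "\<dots> = op_app T (ev (?X ^ m) (ev (p ^ k) y))"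
      unfolding app ev_commute[of "p ^ k"] ..
    also have "\<dots> = ev (p ^ Suc k) y"
      using T by (simp add: represents_def ev_mult)
    finally show ?thesis .
  qed
  ultimately show ?case
    unfolding represents_def by blast
qed

lemma range_space_represents:
  assumes "represents T p m"
  shows "range_space T = Range p"
  using assms unfolding represents_def range_space_def by (auto simp: image_image)

text \<open>By \<open>bezout_X\<close>, every vector killed by \<open>p\<close> lies in the domain
  of \<open>T\<close>.\<close>

lemma null_space_represents:
  assumes T: "represents T p m" and p: "coprime p [:0, 1:]"
  shows "null_space T = Null p"
proof (intro equalityI subsetI)
  fix x assume "x \<in> null_space T"
  then obtain y where "x = ev ([:0, 1:] ^ m) y" "ev p y = 0"
    using T unfolding represents_def null_space_def by auto
  then show "x \<in> Null p"
    using ev_commute[of p "[:0, 1:] ^ m" y] by simp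
next
  fix x assume x: "x \<in> Null p"
  obtain a b where "\<And>x. x = ev ([:0, 1:] ^ m) (ev a x) + ev b (ev p x)"
    using bezout_X[OF p] by metis
  from this[of x] x have ax: "x = ev ([:0, 1:] ^ m) (ev a x)" by simp
  then have "op_app T x = ev p (ev a x)"
    using T unfolding represents_def by metis
  also have "\<dots> = 0"
    using x ev_commute[of p a x] by simp
  finally show "x \<in> null_space T"
    using T ax unfolding represents_def null_space_def by blast
qed

text \<open>Clearing the denominator describes the graph by an equation between bounded operators,
  from which its closedness follows. Bezout shows that every solution \<open>x\<close> lies in the
  domain.\<close>

lemma graph_represents:
  assumes T: "represents T p m" and p: "coprime p [:0, 1:]"
  shows "{(x, op_app T x) |x. x \<in> op_dom T} = {(x, z). ev ([:0, 1:] ^ m) z = ev p x}"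
proof (intro equalityI subsetI)
  fix q assume "q \<in> {(x, op_app T x) |x. x \<in> op_dom T}"
  then obtain y where "q = (ev ([:0, 1:] ^ m) y, ev p y)"
    using T unfolding represents_def by auto
  then show "q \<in> {(x, z). ev ([:0, 1:] ^ m) z = ev p x}"
    using ev_commute by simp
next
  fix q assume "q \<in> {(x, z). ev ([:0, 1:] ^ m) z = ev p x}"
  then obtain x z where q: "q = (x, z)" "ev ([:0, 1:] ^ m) z = ev p x" by blast
  obtain a b where ab: "\<And>x. x = ev ([:0, 1:] ^ m) (ev a x) + ev b (ev p x)"
    using bezout_X[OF p] by metis
  have x: "x = ev ([:0, 1:] ^ m) (ev a x + ev b z)"
    using ab[of x] ev_commute[of b "[:0, 1:] ^ m" z] by (simp add: ev_lin_add flip: q(2))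
  then have "op_app T x = ev p (ev a x + ev b z)"
    using T unfolding represents_def by metis
  also have "\<dots> = ev a (ev p x) + ev b (ev p z)"
    using ev_commute[of p a x] ev_commute[of p b z] by (simp add: ev_lin_add)
  also have "\<dots> = z"
    using ab[of z] ev_commute[of a "[:0, 1:] ^ m" z] by (simp flip: q(2))
  finally show "q \<in> {(x, op_app T x) |x. x \<in> op_dom T}"
    using x T q(1) unfolding represents_def by blast
qed

lemma linear_operator_represents:
  assumes "represents T p m"
  shows "linear_operator T"
  unfolding linear_operator_def
proof (intro conjI ballI allI)
  note T = assms[unfolded represents_def]
  show "csubspace (op_dom T)"
    using T subspace_Range by simp
  fix x assume "x \<in> op_dom T"
  then obtain u where u: "x = ev ([:0, 1:] ^ m) u"
    using T by auto
  show "op_app T (c *\<^sub>C x) = c *\<^sub>C op_app T x" for c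
    using T by (simp add: u flip: ev_lin_scale)
  fix y assume "y \<in> op_dom T"
  then obtain v where v: "y = ev ([:0, 1:] ^ m) v"
    using T by auto
  show "op_app T (x + y) = op_app T x + op_app T y"
    using T by (simp add: u v flip: ev_lin_add)
qed

lemma closed_operator_represents:
  assumes "represents T p m" "coprime p [:0, 1:]"
  shows "closed_operator T"
proof -
  have "closed {q. ev ([:0, 1:] ^ m) (snd q) = ev p (fst q)}"
    by (intro closed_Collect_eq bounded_linear.continuous_on[OF bounded_linear_ev] continuous_intros)
  then show ?thesis
    unfolding closed_operator_def graph_represents[OF assms]
    using linear_operator_represents[OF assms(1)] by (simp add: case_prod_unfold)
qed

text \<open>On the common domain, splitting \<open>m = k + (m - k)\<close> turns the
  \<open>k\<close>-th power of \<open>A\<close> into the \<open>k\<close>-th term of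
  \<open>hom_poly\<close>.\<close>

lemma represents_poly:
  assumes A: "represents A [:1, \<mu>:] 1"
  shows "represents (op_poly Q A) (hom_poly \<mu> Q) (degree Q)"
proof -
  let ?X = "[:0, 1:] :: complex poly" and ?m = "degree Q"
  have pow: "represents (op_power A k) ([:1, \<mu>:] ^ k) k" for k
    using represents_power[OF A, of k] coprime_X[of "[:1, \<mu>:]"] by simp
  have app: "op_app (op_power A k) (ev (?X ^ ?m) y) = ev ([:1, \<mu>:] ^ k * ?X ^ (?m - k)) y"
    if "k \<le> ?m" for k y
  proof -
    have "ev (?X ^ ?m) y = ev (?X ^ k) (ev (?X ^ (?m - k)) y)"
      using that by (simp flip: ev_mult power_add)
    then show ?thesis
      using pow[of k] by (simp add: represents_def ev_mult)
  qed
  have "op_app (op_poly Q A) (ev (?X ^ ?m) y) = ev (hom_poly \<mu> Q) y" for y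
    by (simp add: op_poly_def hom_poly_def ev_sum ev_smult app)
  then show ?thesis
    using pow[of ?m] by (simp add: represents_def op_poly_def)
qed

lemma restrict_represents:
  assumes T: "represents T p m" and p: "coprime p [:0, 1:]"
  shows "null_space (op_restrict T n) = Null p \<inter> Range (p ^ n)"
    and "range_space (op_restrict T n) = Range (p ^ Suc n)"
    and "closed (Range (p ^ n)) \<Longrightarrow> closed_operator (op_restrict T n)"
proof -
  have rng: "range_space (op_power T n) = Range (p ^ n)"
    using range_space_represents[OF represents_power[OF T p]] .
  show "null_space (op_restrict T n) = Null p \<inter> Range (p ^ n)"
    using null_space_represents[OF T p] rng by (auto simp: null_space_def op_restrict_def)
  show "range_space (op_restrict T n) = Range (p ^ Suc n)"
  proof (intro equalityI subsetI)
    fix z assume "z \<in> range_space (op_restrict T n)"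
    then obtain x u y where x: "z = op_app T x" "x = ev (p ^ n) u" "x = ev ([:0, 1:] ^ m) y"
      using T rng unfolding range_space_def op_restrict_def represents_def by auto
    \<comment> \<open>Bezout transfers membership in \<open>Range (p ^ n)\<close> from
      \<open>x\<close> to its preimage \<open>y\<close> under the \<open>m\<close>-th power of
      \<open>R\<close>.\<close>
    obtain a b where "\<And>x. x = ev ([:0, 1:] ^ m) (ev a x) + ev b (ev (p ^ n) x)"
      using bezout_X[of "p ^ n" m] p by auto
    then have "y = ev ([:0, 1:] ^ m) (ev a y) + ev b (ev (p ^ n) y)" by blast
    also have "ev ([:0, 1:] ^ m) (ev a y) = ev (p ^ n) (ev a u)"
      using x ev_commute[of a "[:0, 1:] ^ m" y] ev_commute[of a "p ^ n" u] by simp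
    also have "ev b (ev (p ^ n) y) = ev (p ^ n) (ev b y)"
      by (rule ev_commute)
    finally have "ev p y = ev (p ^ Suc n) (ev a u + ev b y)"
      by (simp add: ev_mult flip: ev_lin_add)
    moreover have "z = ev p y"
      using T unfolding x(1) unfolding x(3) by (simp add: represents_def)
    ultimately show "z \<in> Range (p ^ Suc n)" by blast
  next
    fix z assume "z \<in> Range (p ^ Suc n)"
    then obtain w where w: "z = ev p (ev (p ^ n) w)"
      by (auto simp: ev_mult)
    let ?x = "ev ([:0, 1:] ^ m) (ev (p ^ n) w)"
    have "z = op_app T ?x"
      using T w by (simp add: represents_def)
    moreover have "?x \<in> op_dom T \<inter> Range (p ^ n)"
      using T ev_Range[of "ev (p ^ n) w" "p ^ n"] by (auto simp: represents_def)
    ultimately show "z \<in> range_space (op_restrict T n)"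
      using rng unfolding range_space_def op_restrict_def by auto
  qed
  assume cl: "closed (Range (p ^ n))"
  \<comment> \<open>The graph of the restriction is the graph of \<open>T\<close> cut down by a
    closed condition on \<open>x\<close>.\<close>
  have "closed ({(x, op_app T x) |x. x \<in> op_dom T} \<inter> Range (p ^ n) \<times> UNIV)"
    using closed_operator_represents[OF T p] cl unfolding closed_operator_def
    by (intro closed_Int closed_Times) auto
  also have "{(x, op_app T x) |x. x \<in> op_dom T} \<inter> Range (p ^ n) \<times> UNIV =
      {(x, op_app (op_restrict T n) x) |x. x \<in> op_dom (op_restrict T n)}"
    using rng by (auto simp: op_restrict_def)
  finally show "closed_operator (op_restrict T n)"
    using linear_operator_represents[OF T] rng
    unfolding closed_operator_def linear_operator_def op_restrict_def
    by (auto intro!: complex_vector.subspace_inter subspace_Range)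
qed

section \<open>B-Fredholmness and Drazin invertibility read off from the numerator\<close>

lemma finite_codim_in_iff:
  assumes "csubspace U" "U \<subseteq> Y"
    and "csubspace Y"
  shows "finite_codim_in Y U \<longleftrightarrow> (\<exists>G. finite_dim G \<and> (\<forall>y\<in>Y. \<exists>b\<in>U. \<exists>g\<in>G. y = b + g))"
proof
  assume "finite_codim_in Y U"
  then obtain B where B: "finite B" "\<And>y. y \<in> Y \<Longrightarrow> \<exists>b\<in>cspan B. y - b \<in> U"
    unfolding finite_codim_in_def by blast
  have "\<exists>b\<in>U. \<exists>g\<in>cspan B. y = b + g" if y: "y \<in> Y" for y
  proof -
    obtain b where "b \<in> cspan B" "y - b \<in> U"
      using B(2)[OF y] by blast
    then show ?thesis
      by (intro bexI[of _ "y - b"] bexI[of _ b]) auto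
  qed
  moreover have "finite_dim (cspan B)"
    using B(1) finite_dim_iff by auto
  ultimately show "\<exists>G. finite_dim G \<and> (\<forall>y\<in>Y. \<exists>b\<in>U. \<exists>g\<in>G. y = b + g)"
    by blast
next
  assume "\<exists>G. finite_dim G \<and> (\<forall>y\<in>Y. \<exists>b\<in>U. \<exists>g\<in>G. y = b + g)"
  then obtain G where G: "finite_dim G" "\<And>y. y \<in> Y \<Longrightarrow> \<exists>b\<in>U. \<exists>g\<in>G. y = b + g"
    by blast
  \<comment> \<open>\<open>G\<close> may leave \<open>Y\<close>, but the errors that occur equal
    \<open>y - b\<close> and hence lie in \<open>Y\<close>.\<close>
  have "finite_dim (G \<inter> Y)"
    using finite_dim_subset[OF G(1)] by simp
  then obtain B where B: "finite B" "B \<subseteq> G \<inter> Y" "G \<inter> Y \<subseteq> cspan B"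
    unfolding finite_dim_def by blast
  have "\<exists>b\<in>cspan B. y - b \<in> U" if y: "y \<in> Y" for y
  proof -
    obtain b g where b: "b \<in> U" "g \<in> G" "y = b + g"
      using G(2)[OF y] by blast
    have "y - b \<in> Y"
      using y b(1) assms(2) by (intro complex_vector.subspace_diff[OF assms(3)]) auto
    then have "g \<in> cspan B"
      using b B(3) by auto
    then show ?thesis
      using b by (intro bexI[of _ g]) auto
  qed
  then show "finite_codim_in Y U"
    using B unfolding finite_codim_in_def by blast
qed

text \<open>\<open>stabilizes\<close> is the algebraic content of the Fredholm condition at level
  \<open>n\<close>. Closedness comes from \<open>closed_Range\<close>, so the converse picks an
  exponent at which \<open>p ^ n\<close> decomposes.\<close>

lemma b_fredholm_represents:
  assumes T: "represents T p m" and p: "coprime p [:0, 1:]"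
  shows "b_fredholm T \<longleftrightarrow> fredholm.eventually_decomposes p"
proof -
  have rng: "range_space (op_power T n) = Range (p ^ n)" for n
    using range_space_represents[OF represents_power[OF T p]] .
  have codim: "finite_codim_in (Range (p ^ n)) (Range (p ^ Suc n)) \<longleftrightarrow>
      (\<exists>G. finite_dim G \<and> (\<forall>x\<in>Range (p ^ n). \<exists>b\<in>Range (p ^ Suc n). \<exists>g\<in>G. x = b + g))" for n
    by (intro finite_codim_in_iff subspace_Range Range_power_antimono) simp
  have stab: "fredholm.stabilizes p n \<longleftrightarrow> finite_dim (null_space (op_restrict T n)) \<and>
      finite_codim_in (Range (p ^ n)) (range_space (op_restrict T n))" for n
    unfolding fredholm.stabilizes_def restrict_represents(1,2)[OF T p] codim ..
  show ?thesis
  proof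
    assume "b_fredholm T"
    then obtain n where "fredholm_in (Range (p ^ n)) (op_restrict T n)"
      unfolding b_fredholm_def rng by blast
    then have "fredholm.stabilizes p n"
      unfolding stab fredholm_in_def by blast
    then show "fredholm.eventually_decomposes p"
      using fredholm.eventually_decomposes_iff by blast
  next
    assume "fredholm.eventually_decomposes p"
    then obtain n where "n \<ge> 1" and dec: "fredholm.decomposes (p ^ n)"
      unfolding fredholm.eventually_decomposes_def by blast
    then have "fredholm.stabilizes p n"
      by (intro fredholm.decomposes_imp_stabilizes)
    moreover have cl: "closed (Range (p ^ n))"
      using dec by (rule closed_Range)
    moreover have "op_dom (op_restrict T n) \<subseteq> Range (p ^ n)"
      using rng by (simp add: op_restrict_def)
    moreover have "range_space (op_restrict T n) \<subseteq> Range (p ^ n)"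
      unfolding restrict_represents(2)[OF T p] by (rule Range_power_antimono) simp
    ultimately have "fredholm_in (Range (p ^ n)) (op_restrict T n)"
      unfolding fredholm_in_def stab
      using subspace_Range restrict_represents(3)[OF T p] by blast
    then show "b_fredholm T"
      using cl closed_operator_represents[OF T p] rng unfolding b_fredholm_def by metis
  qed
qed

text \<open>With \<open>f = p ^ n\<close>, the vector \<open>f x\<close> lies in the kernel of
  \<open>f\<close> iff \<open>f (f x) = 0\<close>, and \<open>f x = f (f u)\<close> iff
  \<open>x - f u\<close> lies in that kernel.\<close>

lemma drazin_decomposes_iff:
  "drazin.decomposes (p ^ n) \<longleftrightarrow>
    Null (p ^ (n + n)) \<subseteq> Null (p ^ n) \<and> Range (p ^ n) \<subseteq> Range (p ^ (n + n))"
  (is "?dec \<longleftrightarrow> ?null \<and> ?range")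
proof
  let ?f = "ev (p ^ n)"
  have ff: "ev (p ^ (n + n)) x = ?f (?f x)" for x
    by (simp add: power_add ev_mult)
  assume dec: ?dec
  have ?null
  proof
    fix x assume "x \<in> Null (p ^ (n + n))"
    then have "?f x \<in> Null (p ^ n) \<inter> Range (p ^ n)"
      by (simp add: ff)
    then show "x \<in> Null (p ^ n)"
      using dec unfolding drazin.decomposes_def by auto
  qed
  moreover have ?range
  proof
    fix z assume "z \<in> Range (p ^ n)"
    then obtain x where x: "z = ?f x" by blast
    obtain G where "G \<subseteq> {0}" "\<exists>a\<in>Null (p ^ n). \<exists>b\<in>Range (p ^ n). \<exists>g\<in>G. x = a + b + g"
      using dec unfolding drazin.decomposes_def by blast
    then obtain a u where "?f a = 0" "x = a + ?f u" by auto
    then have "z = ev (p ^ (n + n)) u"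
      by (simp add: x ff ev_lin_add)
    then show "z \<in> Range (p ^ (n + n))" by blast
  qed
  ultimately show "?null \<and> ?range" ..
next
  let ?f = "ev (p ^ n)"
  have ff: "ev (p ^ (n + n)) x = ?f (?f x)" for x
    by (simp add: power_add ev_mult)
  assume asm: "?null \<and> ?range"
  have "Null (p ^ n) \<inter> Range (p ^ n) \<subseteq> {0}"
  proof
    fix z assume "z \<in> Null (p ^ n) \<inter> Range (p ^ n)"
    then obtain x where "z = ?f x" "x \<in> Null (p ^ (n + n))"
      by (auto simp: ff)
    then show "z \<in> {0}"
      using asm by auto
  qed
  moreover have "\<exists>a\<in>Null (p ^ n). \<exists>b\<in>Range (p ^ n). \<exists>g\<in>{0}. x = a + b + g" for x
  proof -
    obtain u where "?f x = ?f (?f u)"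
      using asm ff by (metis rangeE rangeI subsetD)
    then show ?thesis
      by (intro bexI[of _ "x - ?f u"] bexI[of _ "?f u"] bexI[of _ 0]) (auto simp: ev_lin_diff)
  qed
  ultimately show ?dec
    unfolding drazin.decomposes_def by blast
qed

text \<open>Finite ascent and descent make both chains constant from some level on, so levels
  \<open>n\<close> and \<open>n + n\<close> agree. Conversely, level \<open>Suc n\<close> is
  squeezed between these two.\<close>

lemma drazin_invertible_represents:
  assumes T: "represents T p m" and p: "coprime p [:0, 1:]"
  shows "drazin_invertible T \<longleftrightarrow> drazin.eventually_decomposes p"
proof -
  have rng: "range_space (op_power T n) = Range (p ^ n)"
    and nul: "null_space (op_power T n) = Null (p ^ n)" for n
    using range_space_represents[OF represents_power[OF T p]]
      null_space_represents[OF represents_power[OF T p]] p by auto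
  have Inf_enat: "Inf {enat n |n. Q n} \<noteq> \<infinity> \<longleftrightarrow> (\<exists>n. Q n)" for Q
  proof
    assume "\<exists>n. Q n"
    then obtain n where "Q n" by blast
    then have "Inf {enat n |n. Q n} \<le> enat n"
      by (intro Inf_lower) auto
    then show "Inf {enat n |n. Q n} \<noteq> \<infinity>"
      by (metis infinity_ileE)
  next
    assume "Inf {enat n |n. Q n} \<noteq> \<infinity>"
    moreover have "Inf ({} :: enat set) = \<infinity>"
      by (simp add: Inf_enat_def)
    ultimately have "{enat n |n. Q n} \<noteq> {}"
      by (intro notI) (simp only: simp_thms)
    then show "\<exists>n. Q n" by blast
  qed
  have *: "drazin_invertible T \<longleftrightarrow> (\<exists>n. Null (p ^ n) = Null (p ^ Suc n)) \<and>
      (\<exists>n. Range (p ^ n) = Range (p ^ Suc n))"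
    unfolding drazin_invertible_def ascent_def descent_def rng nul Inf_enat ..
  show ?thesis
    unfolding *
  proof (intro iffI; (elim conjE exE)?)
    fix a d
    assume a: "Null (p ^ a) = Null (p ^ Suc a)" and d: "Range (p ^ d) = Range (p ^ Suc d)"
    have a': "Null (p ^ (a + k)) = Null (p ^ a)" for k
    proof (induction k)
      case (Suc k)
      have "x \<in> Null (p ^ (a + Suc k)) \<longleftrightarrow> ev p x \<in> Null (p ^ (a + k))" for x
        by (simp add: mult.commute[of p] ev_mult)
      moreover have "x \<in> Null (p ^ Suc a) \<longleftrightarrow> ev p x \<in> Null (p ^ a)" for x
        by (simp add: mult.commute[of p] ev_mult)
      ultimately show ?case
        using Suc a by blast
    qed simp
    have d': "Range (p ^ (d + k)) = Range (p ^ d)" for k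
    proof (induction k)
      case (Suc k)
      have "Range (p ^ (d + Suc k)) = ev p ` Range (p ^ (d + k))"
        by (simp add: ev_mult image_image)
      also have "\<dots> = Range (p ^ Suc d)"
        unfolding Suc by (simp add: ev_mult image_image)
      finally show ?case
        using d by simp
    qed simp
    \<comment> \<open>\<open>Suc\<close> secures the positive exponent that
      \<open>eventually_decomposes\<close> requires.\<close>
    define n where "n = Suc (max a d)"
    have "Null (p ^ (n + n)) = Null (p ^ n)"
      using a'[of "n - a"] a'[of "n + n - a"] by (simp add: n_def)
    moreover have "Range (p ^ (n + n)) = Range (p ^ n)"
      using d'[of "n - d"] d'[of "n + n - d"] by (simp add: n_def)
    ultimately have "drazin.decomposes (p ^ n)"
      unfolding drazin_decomposes_iff by blast
    then show "drazin.eventually_decomposes p"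
      unfolding drazin.eventually_decomposes_def by (intro exI[of _ n]) (simp add: n_def)
  next
    assume "drazin.eventually_decomposes p"
    then obtain n where n: "n \<ge> 1" "Null (p ^ (n + n)) \<subseteq> Null (p ^ n)"
      "Range (p ^ n) \<subseteq> Range (p ^ (n + n))"
      unfolding drazin.eventually_decomposes_def drazin_decomposes_iff by blast
    have "Null (p ^ n) = Null (p ^ Suc n)"
      using Null_power_mono[of n "Suc n" p] Null_power_mono[of "Suc n" "n + n" p] n(1,2) by simp
    moreover have "Range (p ^ n) = Range (p ^ Suc n)"
      using Range_power_antimono[of n "Suc n" p] Range_power_antimono[of "Suc n" "n + n" p] n(1,3)
      by simp
    ultimately show "(\<exists>n. Null (p ^ n) = Null (p ^ Suc n)) \<and> (\<exists>n. Range (p ^ n) = Range (p ^ Suc n))"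
      by blast
  qed
qed

end

section \<open>The spectral mapping theorem\<close>

lemma op_shift_eq_op_poly: "op_shift A \<zeta> = op_poly [:- \<zeta>, 1:] A"
  by (simp add: op_shift_def op_poly_def)

lemma op_shift_op_poly: "op_shift (op_poly P A) \<nu> = op_poly (P - [:\<nu>:]) A"
proof -
  \<comment> \<open>Subtracting a constant preserves the degree, and so the domain, even for
    constant \<open>P\<close>, since the zero polynomial has degree 0.\<close>
  have deg: "degree (P - [:\<nu>:]) = degree P"
    by (cases P) (auto simp: degree_pCons_eq_if)
  have "(\<Sum>k\<le>degree P. coeff (P - [:\<nu>:]) k *\<^sub>C op_app (op_power A k) x) =
      (\<Sum>k\<le>degree P. coeff P k *\<^sub>C op_app (op_power A k) x - (if k = 0 then \<nu> *\<^sub>C x else 0))" for x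
    by (intro sum.cong) (auto simp: coeff_pCons complex_vector.scale_left_diff_distrib split: nat.split)
  then show ?thesis
    by (simp add: op_shift_def op_poly_def deg sum_subtractf)
qed

text \<open>As \<open>R\<close> inverts \<open>A - \<mu>\<close>, applying \<open>A\<close> to
  \<open>R y\<close> gives \<open>y + \<mu> *\<^sub>C R y\<close>, so the numerator is
  \<open>[:1, \<mu>:]\<close>.\<close>

lemma resolvent_represents:
  assumes A: "linear_operator A" and \<mu>: "\<mu> \<in> resolvent_set A"
  defines "R \<equiv> inv_into (op_dom A) (op_app (op_shift A \<mu>))"
  shows "bounded_op R" and "bounded_op.represents R A [:1, \<mu>:] 1"
proof -
  have bij: "bij_betw (\<lambda>x. op_app A x - \<mu> *\<^sub>C x) (op_dom A) UNIV" and bdd: "bounded_linear R"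
    using \<mu> by (simp_all add: resolvent_set_def R_def op_shift_def)
  have R: "R y \<in> op_dom A" "op_app A (R y) - \<mu> *\<^sub>C R y = y" for y
    using bij inv_into_into[of y "\<lambda>x. op_app A x - \<mu> *\<^sub>C x" "op_dom A"]
      f_inv_into_f[of y "\<lambda>x. op_app A x - \<mu> *\<^sub>C x" "op_dom A"]
    by (auto simp: R_def op_shift_def bij_betw_def)
  have R_eq: "R (op_app A x - \<mu> *\<^sub>C x) = x" if "x \<in> op_dom A" for x
    using inv_into_f_f[OF bij_betw_imp_inj_on[OF bij] that] by (simp add: R_def op_shift_def)
  show "bounded_op R"
  proof (rule bounded_op.intro)
    show "bounded_linear R" by (fact bdd)
    \<comment> \<open>\<open>bounded_linear\<close> provides only real linearity; complex
      homogeneity is inherited from \<open>A\<close>.\<close>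
    show "R (c *\<^sub>C x) = c *\<^sub>C R x" for c x
    proof -
      have "c *\<^sub>C R x \<in> op_dom A"
        using A R(1) complex_vector.subspace_scale unfolding linear_operator_def by blast
      moreover have "op_app A (c *\<^sub>C R x) - \<mu> *\<^sub>C c *\<^sub>C R x = c *\<^sub>C (op_app A (R x) - \<mu> *\<^sub>C R x)"
        using A R(1) unfolding linear_operator_def
        by (simp add: complex_vector.scale_right_diff_distrib mult.commute)
      ultimately show ?thesis
        using R_eq R(2) by metis
    qed
  qed
  then interpret bounded_op R .
  have "op_dom A = range R"
    using R(1) R_eq by (auto simp: image_iff) metis
  moreover have "op_app A (R y) = y + \<mu> *\<^sub>C R y" for y
    using R(2)[of y] by (simp add: diff_eq_eq)
  moreover have "ev [:0, 1:] y = R y" "ev [:1, \<mu>:] y = y + \<mu> *\<^sub>C R y" for y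
    by (simp_all add: ev_pCons scale)
  ultimately show "represents A [:1, \<mu>:] 1"
    by (simp add: represents_def)
qed

text \<open>With \<open>\<zeta>\<close> itself as the base point, the shifted operator is the
  inverse of the resolvent and has numerator 1.\<close>

lemma drazin_spectrum_subset_spectrum:
  assumes "linear_operator T"
  shows "drazin_spectrum T \<subseteq> spectrum T"
proof
  fix \<zeta> assume "\<zeta> \<in> drazin_spectrum T"
  show "\<zeta> \<in> spectrum T"
  proof (rule ccontr)
    assume "\<zeta> \<notin> spectrum T"
    then interpret bounded_op "inv_into (op_dom T) (op_app (op_shift T \<zeta>))"
      using resolvent_represents(1)[OF assms] by (simp add: spectrum_def)
    have "represents T [:1, \<zeta>:] 1"
      using resolvent_represents(2)[OF assms] \<open>\<zeta> \<notin> spectrum T\<close> by (simp add: spectrum_def)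
    then have "represents (op_shift T \<zeta>) [:1:] 1"
      using represents_poly[of T \<zeta> "[:- \<zeta>, 1:]"] by (simp add: op_shift_eq_op_poly hom_poly_linear)
    then have "drazin_invertible (op_shift T \<zeta>)"
      using drazin_invertible_represents coprime_X[of "[:1:]"] drazin.eventually_decomposes_const[of 1]
      by simp
    then show False
      using \<open>\<zeta> \<in> drazin_spectrum T\<close> by (simp add: drazin_spectrum_def)
  qed
qed

lemma purely_b_discrete_iff:
  assumes "linear_operator T"
  shows "purely_b_discrete T \<longleftrightarrow> drazin_spectrum T = {}"
  using drazin_spectrum_subset_spectrum[OF assms]
  unfolding purely_b_discrete_def b_discrete_spectrum_def by blast

theorem theorem3p5:
  fixes A :: "'a::complex_banach operator" and P :: "complex poly"
  assumes "closed_operator A"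
    and "densely_defined A"
    and "resolvent_set A \<noteq> {}"
    and "degree P \<ge> 1"
  shows "b_fredholm_spectrum (op_poly P A) = poly P ` b_fredholm_spectrum A \<and>
    (purely_b_discrete A \<longleftrightarrow> purely_b_discrete (op_poly P A))"
proof -
  obtain \<mu> where \<mu>: "\<mu> \<in> resolvent_set A"
    using assms(3) by blast
  have linA: "linear_operator A"
    using assms(1) by (simp add: closed_operator_def)
  define R where "R = inv_into (op_dom A) (op_app (op_shift A \<mu>))"
  interpret bounded_op R
    unfolding R_def using resolvent_represents(1)[OF linA \<mu>] .
  have A: "represents A [:1, \<mu>:] 1"
    using resolvent_represents(2)[OF linA \<mu>] by (simp add: R_def)
  have cop: "coprime (hom_poly \<mu> Q) [:0, 1:]" if "Q \<noteq> 0" for Q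
    using that by (intro coprime_X) (simp add: poly_hom_poly_0)
  \<comment> \<open>The degree bound keeps \<open>P - [:\<nu>:]\<close> non-zero for every
    \<open>\<nu>\<close>, as coprimality to the variable and the splitting into roots
    require.\<close>
  have nz: "P - [:\<nu>:] \<noteq> 0" for \<nu>
    using assms(4) by auto
  have lin: "b_fredholm (op_shift A \<zeta>) \<longleftrightarrow> fredholm.eventually_decomposes (hom_poly \<mu> [:- \<zeta>, 1:])"
    "drazin_invertible (op_shift A \<zeta>) \<longleftrightarrow> drazin.eventually_decomposes (hom_poly \<mu> [:- \<zeta>, 1:])" for \<zeta>
    unfolding op_shift_eq_op_poly
    using b_fredholm_represents[OF represents_poly[OF A] cop]
      drazin_invertible_represents[OF represents_poly[OF A] cop] by simp_all
  have "b_fredholm (op_shift (op_poly P A) \<nu>) \<longleftrightarrow>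
      (\<forall>\<zeta>. poly P \<zeta> = \<nu> \<longrightarrow> b_fredholm (op_shift A \<zeta>))" for \<nu>
    unfolding op_shift_op_poly lin b_fredholm_represents[OF represents_poly[OF A] cop[OF nz]]
      fredholm.eventually_decomposes_hom_poly[OF nz] by simp
  \<comment> \<open>By negation, \<open>\<nu>\<close> is in the spectrum of \<open>P(A)\<close> iff
    some preimage of \<open>\<nu>\<close> under \<open>P\<close> is in that of
    \<open>A\<close>.\<close>
  then have "b_fredholm_spectrum (op_poly P A) = poly P ` b_fredholm_spectrum A"
    unfolding b_fredholm_spectrum_def by auto
  moreover have "drazin_invertible (op_shift (op_poly P A) \<nu>) \<longleftrightarrow>
      (\<forall>\<zeta>. poly P \<zeta> = \<nu> \<longrightarrow> drazin_invertible (op_shift A \<zeta>))" for \<nu>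
    unfolding op_shift_op_poly lin drazin_invertible_represents[OF represents_poly[OF A] cop[OF nz]]
      drazin.eventually_decomposes_hom_poly[OF nz] by simp
  then have "drazin_spectrum (op_poly P A) = poly P ` drazin_spectrum A"
    unfolding drazin_spectrum_def by auto
  moreover have linP: "linear_operator (op_poly P A)"
    using linear_operator_represents[OF represents_poly[OF A]] .
  \<comment> \<open>An image is empty exactly when the original set is.\<close>
  ultimately show ?thesis
    unfolding purely_b_discrete_iff[OF linA] purely_b_discrete_iff[OF linP] by simp
qed

end
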